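(* If $G$ is a connected planar graph of order $n\geq 2$, then $b_{dR}(G)\leq 8$.
   Context: All graphs are finite, simple and undirected. For a graph $G=(V,E)$, a double Roman dominating function (DRDF) is a function $f:V\to\{0,1,2,3\}$ such that every vertex $v$ with $f(v)=0$ has at least two neighbors $u$ with $f(u)=2$ or at least one neighbor $w$ with $f(w)=3$, and every vertex $v$ with $f(v)=1$ has at least one neighbor $w$ with $f(w)\geq 2$. The weight of $f$ is $\sum_{u\in V}f(u)$, and $\gamma_{dR}(G)$ is the minimum weight of a DRDF on $G$. The double Roman bondage number $b_{dR}(G)$ is the minimum cardinality of an edge set $B\subseteq E(G)$ such that $\gamma_{dR}(G-B)>\gamma_{dR}(G)$. *)

theory Defs
  imports "HOL-Analysis.Analysis" "HOL-Library.Extended_Nat"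
begin

definition simple_graph :: "'a set \<Rightarrow> 'a set set \<Rightarrow> bool" where
  "simple_graph V E \<longleftrightarrow> finite V \<and> (\<forall>e\<in>E. e \<subseteq> V \<and> card e = 2)"

definition neighbors :: "'a set set \<Rightarrow> 'a \<Rightarrow> 'a set" where
  "neighbors E v = {u. {v, u} \<in> E}"

definition connected_graph :: "'a set \<Rightarrow> 'a set set \<Rightarrow> bool" where
  "connected_graph V E \<longleftrightarrow> V \<noteq> {} \<and> (\<forall>u\<in>V. \<forall>v\<in>V. (u, v) \<in> {(x, y). {x, y} \<in> E}\<^sup>*)"

definition plane_drawing ::
    "'a set \<Rightarrow> 'a set set \<Rightarrow> ('a \<Rightarrow> complex) \<Rightarrow> ('a set \<Rightarrow> real \<Rightarrow> complex) \<Rightarrow> bool" where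
  "plane_drawing V E p g \<longleftrightarrow>
     inj_on p V \<and>
     (\<forall>e\<in>E. arc (g e) \<and> {pathstart (g e), pathfinish (g e)} = p ` e \<and>
             path_image (g e) \<inter> p ` V = p ` e) \<and>
     (\<forall>e\<in>E. \<forall>e'\<in>E. e \<noteq> e' \<longrightarrow> path_image (g e) \<inter> path_image (g e') = p ` (e \<inter> e'))"

definition planar_graph :: "'a set \<Rightarrow> 'a set set \<Rightarrow> bool" where
  "planar_graph V E \<longleftrightarrow> (\<exists>p g. plane_drawing V E p g)"

definition drdf :: "'a set \<Rightarrow> 'a set set \<Rightarrow> ('a \<Rightarrow> nat) \<Rightarrow> bool" where
  "drdf V E f \<longleftrightarrow>
     f ` V \<subseteq> {0, 1, 2, 3} \<and>
     (\<forall>v\<in>V. f v = 0 \<longrightarrow>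
        card {u \<in> neighbors E v. f u = 2} \<ge> 2 \<or> (\<exists>w\<in>neighbors E v. f w = 3)) \<and>
     (\<forall>v\<in>V. f v = 1 \<longrightarrow> (\<exists>w\<in>neighbors E v. f w \<ge> 2))"

definition gamma_dR :: "'a set \<Rightarrow> 'a set set \<Rightarrow> nat" where
  "gamma_dR V E = Inf {(\<Sum>u\<in>V. f u) | f. drdf V E f}"

text \<open>
  The value is extended natural so that it is infinite, rather than 0, for a graph in which no
  set of edges raises the double Roman domination number.
\<close>

definition b_dR :: "'a set \<Rightarrow> 'a set set \<Rightarrow> enat" where
  "b_dR V E = (INF B \<in> {B. B \<subseteq> E \<and> gamma_dR V (E - B) > gamma_dR V E}. enat (card B))"

end

theory Submission
  imports Defs
begin

text \<open>
  Write \<open>d\<close> for the degree and \<open>t(u, v)\<close> for the number of common neighbours of \<open>u\<close> and \<open>v\<close>.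
  Isolating a vertex \<open>u\<close> forces the value 2 on it. If one also deletes the edges of a neighbour
  \<open>v\<close> that lead outside the closed neighbourhood of \<open>u\<close>, then restoring all edges lets \<open>u\<close> drop
  to 1; hence \<open>b_dR \<le> d(u) + d(v) - 1 - t(u, v)\<close> for adjacent \<open>u, v\<close>, and a similar exchange
  gives \<open>b_dR \<le> d(u) + d(v) - 1\<close> for vertices with a common neighbour.

  Faces are the components of the complement of the drawing. The Jordan curve theorem shows
  that adding an edge between linked vertices creates a face, which gives the relevant half of
  Euler's formula, and Janiszewski's theorem shows that an edge lies on at most two faces, a
  bridge on at most one. Every face has at least three boundary edges, and one with exactly
  three is bounded by a triangle. Sharing each face among its edges gives a lower bound
  on the number of vertices in which the faces appear only through \<open>t\<close>. Discharging along the
  edges shows that this bound fails if both degree conditions hold with \<open>b_dR \<ge> 9\<close>.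
\<close>

section \<open>Double Roman dominating functions and how to modify them\<close>

lemma neighbors_sym: "u \<in> neighbors E v \<longleftrightarrow> v \<in> neighbors E u"
  by (simp add: neighbors_def insert_commute)

lemma simple_graph_finite_edges: "simple_graph V E \<Longrightarrow> finite E"
  unfolding simple_graph_def by (meson PowI finite_Pow_iff finite_subset subsetI)

lemma simple_graph_neighbors:
  assumes "simple_graph V E" and "u \<in> neighbors E v"
  shows "u \<in> V" "v \<in> V" "u \<noteq> v"
  using assms by (auto simp: simple_graph_def neighbors_def card_2_iff doubleton_eq_iff)

lemma simple_graph_finite_neighbors:
  assumes "simple_graph V E"
  shows "finite (neighbors E v)"
proof (rule finite_subset)
  show "neighbors E v \<subseteq> V"
    using simple_graph_neighbors[OF assms] by blast
  show "finite V"
    using assms by (simp add: simple_graph_def)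
qed

lemma gamma_dR_attained: "\<exists>f. drdf V E f \<and> gamma_dR V E = (\<Sum>u\<in>V. f u)"
proof -
  have "drdf V E (\<lambda>_. 2)"
    by (auto simp: drdf_def)
  then have "{(\<Sum>u\<in>V. f u) | f. drdf V E f} \<noteq> {}"
    by blast
  from Inf_nat_def1[OF this] show ?thesis
    unfolding gamma_dR_def by auto
qed

lemma gamma_dR_le: "drdf V E f \<Longrightarrow> gamma_dR V E \<le> (\<Sum>u\<in>V. f u)"
  unfolding gamma_dR_def by (rule wellorder_Inf_le1) blast

lemma gamma_dR_lessI:
  assumes "\<And>f. drdf V E' f \<Longrightarrow> \<exists>f'. drdf V E f' \<and> sum f' V < sum f V"
  shows "gamma_dR V E < gamma_dR V E'"
proof -
  obtain f where "drdf V E' f" "gamma_dR V E' = sum f V"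
    using gamma_dR_attained by blast
  moreover obtain f' where "drdf V E f'" "sum f' V < sum f V"
    using assms[OF \<open>drdf V E' f\<close>] by blast
  ultimately show ?thesis
    using gamma_dR_le[of V E f'] by linarith
qed

lemma b_dR_le:
  assumes "B \<subseteq> E" "gamma_dR V E < gamma_dR V (E - B)" "card B \<le> k"
  shows "b_dR V E \<le> enat k"
proof -
  have "b_dR V E \<le> enat (card B)"
    unfolding b_dR_def by (rule INF_lower) (use assms in auto)
  also have "\<dots> \<le> enat k"
    using assms by simp
  finally show ?thesis .
qed

lemma drdf_isolated_ge_2:
  assumes "drdf V E f" "u \<in> V" "neighbors E u = {}"
  shows "f u \<ge> 2"
proof -
  have "f u \<noteq> 0" "f u \<noteq> 1"
    using assms by (auto simp: drdf_def)
  then show ?thesis by linarith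
qed

lemma drdf_nonbig_has_big_neighbor:
  assumes "drdf V E f" "v \<in> V" "f v < 2"
  shows "\<exists>w\<in>neighbors E v. f w \<ge> 2"
proof (cases "f v = 0")
  case True
  then have "card {u \<in> neighbors E v. f u = 2} \<ge> 2 \<or> (\<exists>w\<in>neighbors E v. f w = 3)"
    using assms by (auto simp: drdf_def)
  moreover have "\<exists>w\<in>neighbors E v. f w = 2" if "card {u \<in> neighbors E v. f u = 2} \<ge> 2"
  proof -
    have "{u \<in> neighbors E v. f u = 2} \<noteq> {}"
      using that by (metis card.empty not_numeral_le_zero)
    then show ?thesis by blast
  qed
  ultimately show ?thesis
    by force
next
  case False
  then have "f v = 1"
    using assms(3) by linarith
  then show ?thesis
    using assms(1,2) by (auto simp: drdf_def)
qed

text \<open>All vertices whose value changes go into \<open>D\<close> and are checked afresh. A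
  vertex outside \<open>D\<close> keeps its value and every neighbour that dominated it in
  \<open>E'\<close>, so its condition survives the passage to the larger edge set. Inside
  \<open>D\<close>, value 0 is only ever justified by a neighbour of value 3.\<close>

lemma drdf_reassign:
  assumes sg: "simple_graph V E" and "E' \<subseteq> E" and f: "drdf V E' f"
    and range: "f' ` V \<subseteq> {0, 1, 2, 3}"
    and D0: "\<And>v. v \<in> D \<Longrightarrow> f' v = 0 \<Longrightarrow> \<exists>w\<in>neighbors E v. f' w = 3"
    and D1: "\<And>v. v \<in> D \<Longrightarrow> f' v = 1 \<Longrightarrow> \<exists>w\<in>neighbors E v. f' w \<ge> 2"
    and out: "\<And>v. v \<in> V \<Longrightarrow> v \<notin> D \<Longrightarrow> f' v = f v"
    and nb: "\<And>v w. v \<in> V \<Longrightarrow> v \<notin> D \<Longrightarrow> w \<in> neighbors E' v \<Longrightarrow> f w \<ge> 2 \<Longrightarrow> f' w = f w"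
  shows "drdf V E f'"
  unfolding drdf_def
proof (intro conjI ballI impI)
  show "f' ` V \<subseteq> {0, 1, 2, 3}" by fact
next
  fix v assume v: "v \<in> V" "f' v = 0"
  have sub: "neighbors E' v \<subseteq> neighbors E v"
    using \<open>E' \<subseteq> E\<close> by (auto simp: neighbors_def)
  show "card {u \<in> neighbors E v. f' u = 2} \<ge> 2 \<or> (\<exists>w\<in>neighbors E v. f' w = 3)"
  proof (cases "v \<in> D")
    case False
    then have "f v = 0" using out v by auto
    then consider "card {u \<in> neighbors E' v. f u = 2} \<ge> 2" | w where "w \<in> neighbors E' v" "f w = 3"
      using f v by (auto simp: drdf_def)
    then show ?thesis
    proof cases
      case 1
      have "{u \<in> neighbors E' v. f u = 2} \<subseteq> {u \<in> neighbors E v. f' u = 2}"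
        using nb[OF v(1) False] sub by auto
      then have "card {u \<in> neighbors E' v. f u = 2} \<le> card {u \<in> neighbors E v. f' u = 2}"
        by (intro card_mono) (auto simp: simple_graph_finite_neighbors[OF sg])
      then show ?thesis using 1 by linarith
    next
      case 2
      then show ?thesis using nb[OF v(1) False, of w] sub by auto
    qed
  qed (use D0 v in blast)
next
  fix v assume v: "v \<in> V" "f' v = 1"
  show "\<exists>w\<in>neighbors E v. f' w \<ge> 2"
  proof (cases "v \<in> D")
    case False
    then have "f v = 1" using out v by auto
    then obtain w where "w \<in> neighbors E' v" "f w \<ge> 2"
      using f v by (auto simp: drdf_def)
    then show ?thesis
      using nb[OF v(1) False, of w] \<open>E' \<subseteq> E\<close> by (auto simp: neighbors_def)
  qed (use D1 v in blast)
qed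

text \<open>In \<open>E'\<close> the vertex \<open>u\<close> must pay at least 2 and dominates
  nobody. With its edges restored, the neighbour \<open>w\<close> supports the value 1 on
  \<open>u\<close>, which saves weight.\<close>

lemma drdf_lower_isolated:
  assumes sg: "simple_graph V E" and "E' \<subseteq> E" and f: "drdf V E' f"
    and u: "u \<in> V" "neighbors E' u = {}" and w: "w \<in> neighbors E u" "f w \<ge> 2"
  shows "\<exists>f'. drdf V E f' \<and> sum f' V < sum f V"
proof (intro exI conjI)
  have "w \<noteq> u"
    using simple_graph_neighbors[OF sg w(1)] by auto
  then show "drdf V E (f(u := 1))"
  proof (intro drdf_reassign[OF sg \<open>E' \<subseteq> E\<close> f, where D = "{u}"])
    show "(f(u := 1)) ` V \<subseteq> {0, 1, 2, 3}"
      using f by (auto simp: drdf_def)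
    fix x y assume "x \<in> V" "x \<notin> {u}" "y \<in> neighbors E' x" "f y \<ge> 2"
    moreover have "u \<notin> neighbors E' x"
      using u(2) neighbors_sym[of u E' x] by auto
    ultimately show "(f(u := 1)) y = f y" by auto
  qed (use w in auto)
  have "finite V" using sg by (simp add: simple_graph_def)
  then show "sum (f(u := 1)) V < sum f V"
    using drdf_isolated_ge_2[OF f u] u
    by (intro sum_strict_mono_ex1) (auto intro!: bexI[of _ u])
qed

section \<open>Degree bounds on the bondage number\<close>

lemma
  assumes "simple_graph V E"
  shows edges_at_eq_image: "{e \<in> E. u \<in> e} = (\<lambda>x. {u, x}) ` neighbors E u"
    and card_edges_at: "card {e \<in> E. u \<in> e} = card (neighbors E u)"
proof -
  show eq: "{e \<in> E. u \<in> e} = (\<lambda>x. {u, x}) ` neighbors E u"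
  proof
    show "{e \<in> E. u \<in> e} \<subseteq> (\<lambda>x. {u, x}) ` neighbors E u"
    proof
      fix e assume e: "e \<in> {e \<in> E. u \<in> e}"
      then obtain a b where "e = {a, b}"
        using assms by (auto simp: simple_graph_def card_2_iff)
      with e have "e = {u, if u = a then b else a}" "e \<in> E"
        by auto
      then show "e \<in> (\<lambda>x. {u, x}) ` neighbors E u"
        by (auto simp: neighbors_def)
    qed
  qed (auto simp: neighbors_def)
  show "card {e \<in> E. u \<in> e} = card (neighbors E u)"
    unfolding eq by (rule card_image) (auto simp: inj_on_def doubleton_eq_iff)
qed

text \<open>After deletion of \<open>B\<close>, all neighbours of \<open>v\<close> lie in the
  neighbourhood of \<open>u\<close>. Hence \<open>v\<close> or one of them has value at least 2, and
  this vertex is a neighbour of \<open>u\<close> in \<open>E\<close>. The bound is stated additively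
  to avoid truncated subtraction; it also forces \<open>b_dR V E\<close> to be finite.\<close>

lemma b_dR_le_adjacent:
  assumes sg: "simple_graph V E" and uv: "{u, v} \<in> E"
  shows "b_dR V E + enat (card (neighbors E u \<inter> neighbors E v)) + 1
    \<le> enat (card (neighbors E u) + card (neighbors E v))"
proof -
  let ?N = "neighbors E"
  define B where "B = {e \<in> E. u \<in> e} \<union> (\<lambda>x. {v, x}) ` (?N v - ?N u - {u})"
  have fin: "finite (?N x)" for x
    by (rule simple_graph_finite_neighbors[OF sg])
  have "v \<in> ?N u" "u \<in> ?N v"
    using uv by (auto simp: neighbors_def insert_commute)
  then have v: "v \<in> ?N u" "u \<in> ?N v" "u \<noteq> v" "u \<in> V" "v \<in> V" "u \<notin> ?N u"
    using simple_graph_neighbors[OF sg] by blast+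
  have "card B \<le> card {e \<in> E. u \<in> e} + card ((\<lambda>x. {v, x}) ` (?N v - ?N u - {u}))"
    unfolding B_def by (rule card_Un_le)
  also have "\<dots> \<le> card (?N u) + card (?N v - ?N u - {u})"
    using card_edges_at[OF sg, of u] card_image_le[of "?N v - ?N u - {u}" "\<lambda>x. {v, x}"] fin
    by simp
  also have "card (?N v - ?N u - {u}) = card (?N v) - card (?N u \<inter> ?N v) - 1"
    using v fin by (simp add: card_Diff_subset_Int Int_commute)
  finally have cB: "card B \<le> card (?N u) + (card (?N v) - card (?N u \<inter> ?N v) - 1)" .
  have "card (insert u (?N u \<inter> ?N v)) \<le> card (?N v)"
    using v fin by (intro card_mono) auto
  then have less: "card (?N u \<inter> ?N v) + 1 \<le> card (?N v)"
    using v fin by simp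
  have "gamma_dR V E < gamma_dR V (E - B)"
  proof (rule gamma_dR_lessI)
    fix f assume f: "drdf V (E - B) f"
    have iso: "neighbors (E - B) u = {}"
      by (auto simp: neighbors_def B_def)
    have Nv: "neighbors (E - B) v \<subseteq> ?N u"
    proof
      fix x assume "x \<in> neighbors (E - B) v"
      then have "{v, x} \<in> E" "{v, x} \<notin> B" by (auto simp: neighbors_def)
      then have "x \<in> ?N v" "x \<notin> ?N v - ?N u - {u}" "x \<noteq> u"
        by (auto simp: neighbors_def B_def)
      then show "x \<in> ?N u" by blast
    qed
    have "\<exists>w\<in>?N u. f w \<ge> 2"
    proof (cases "f v \<ge> 2")
      case False
      then show ?thesis
        using drdf_nonbig_has_big_neighbor[OF f, of v] v Nv by auto
    qed (use v in blast)
    then show "\<exists>f'. drdf V E f' \<and> sum f' V < sum f V"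
      using drdf_lower_isolated[OF sg _ f \<open>u \<in> V\<close> iso] by blast
  qed
  moreover have "B \<subseteq> E"
    by (auto simp: B_def neighbors_def)
  ultimately have "b_dR V E \<le> enat (card (?N u) + (card (?N v) - card (?N u \<inter> ?N v) - 1))"
    using cB by (intro b_dR_le) auto
  then obtain m where m: "b_dR V E = enat m"
    "m \<le> card (?N u) + (card (?N v) - card (?N u \<inter> ?N v) - 1)"
    by (cases "b_dR V E") auto
  then show ?thesis
    using less by (simp add: one_enat_def)
qed

text \<open>Delete every edge at \<open>u\<close> and every edge at \<open>v\<close> except the one
  to \<open>w\<close>. If \<open>w\<close> has value at least 2, then \<open>u\<close> can drop to
  1. Otherwise \<open>u\<close> and \<open>v\<close> both pay at least 2, and a single 3 on
  \<open>w\<close> replaces them.\<close>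

lemma b_dR_le_common_neighbor:
  assumes sg: "simple_graph V E" and "u \<noteq> v" and w: "w \<in> neighbors E u" "w \<in> neighbors E v"
  shows "b_dR V E + 1 \<le> enat (card (neighbors E u) + card (neighbors E v))"
proof -
  let ?N = "neighbors E"
  define B where "B = {e \<in> E. u \<in> e} \<union> (\<lambda>x. {v, x}) ` (?N v - {w})"
  have fin: "finite (?N x)" for x
    by (rule simple_graph_finite_neighbors[OF sg])
  have V: "u \<in> V" "v \<in> V" "w \<in> V" "u \<noteq> w" "v \<noteq> w"
    using w simple_graph_neighbors[OF sg] by blast+
  have finV: "finite V" using sg by (simp add: simple_graph_def)
  have "card B \<le> card {e \<in> E. u \<in> e} + card ((\<lambda>x. {v, x}) ` (?N v - {w}))"
    unfolding B_def by (rule card_Un_le)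
  also have "\<dots> \<le> card (?N u) + card (?N v - {w})"
    using card_edges_at[OF sg, of u] card_image_le[of "?N v - {w}" "\<lambda>x. {v, x}"] fin
    by simp
  finally have cB: "card B \<le> card (?N u) + (card (?N v) - 1)"
    using w by simp
  have pos: "card (?N v) \<ge> 1"
    using w fin by (metis One_nat_def Suc_leI card_gt_0_iff empty_iff)
  have "gamma_dR V E < gamma_dR V (E - B)"
  proof (rule gamma_dR_lessI)
    fix f assume f: "drdf V (E - B) f"
    have iso: "neighbors (E - B) u = {}"
      by (auto simp: neighbors_def B_def)
    have Nv: "neighbors (E - B) v \<subseteq> {w}"
      by (auto simp: neighbors_def B_def)
    show "\<exists>f'. drdf V E f' \<and> sum f' V < sum f V"
    proof (cases "f w \<ge> 2")
      case True
      then show ?thesis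
        using drdf_lower_isolated[OF sg _ f \<open>u \<in> V\<close> iso w(1)] by blast
    next
      case False
      then have fv: "f v \<ge> 2"
        using drdf_nonbig_has_big_neighbor[OF f \<open>v \<in> V\<close>] Nv by fastforce
      have fu: "f u \<ge> 2"
        by (rule drdf_isolated_ge_2[OF f \<open>u \<in> V\<close> iso])
      \<comment> \<open>No vertex outside \<open>{u, v, w}\<close> loses a dominating neighbour: in
        \<open>E - B\<close>, \<open>u\<close> is isolated and \<open>v\<close> has at most the
        neighbour \<open>w\<close>, while \<open>w\<close> only gains value.\<close>
      let ?f = "f(u := 0, v := 0, w := 3)"
      have "drdf V E ?f"
      proof (intro drdf_reassign[OF sg _ f, where D = "{u, v, w}"])
        show "?f ` V \<subseteq> {0, 1, 2, 3}"
          using f by (auto simp: drdf_def)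
        fix x y assume x: "x \<in> V" "x \<notin> {u, v, w}" "y \<in> neighbors (E - B) x" "f y \<ge> 2"
        moreover have "u \<notin> neighbors (E - B) x" "v \<notin> neighbors (E - B) x"
          using iso Nv x neighbors_sym[of u _ x] neighbors_sym[of v _ x] by auto
        ultimately show "?f y = f y" using False by auto
      qed (use w V in \<open>auto split: if_splits\<close>)
      moreover have "sum ?f V < sum f V"
      proof -
        have split: "sum h V = h u + (h v + (h w + sum h (V - {u} - {v} - {w})))" for h :: "'a \<Rightarrow> nat"
          using V \<open>u \<noteq> v\<close> finV by (simp add: sum.remove[of _ u] sum.remove[of _ v] sum.remove[of _ w])
        have "sum ?f (V - {u} - {v} - {w}) = sum f (V - {u} - {v} - {w})"
          by (rule sum.cong) auto
        then show ?thesis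
          using V \<open>u \<noteq> v\<close> fu fv split[of f] split[of ?f] by simp
      qed
      ultimately show ?thesis by blast
    qed
  qed
  moreover have "B \<subseteq> E"
    by (auto simp: B_def neighbors_def)
  ultimately have "b_dR V E \<le> enat (card (?N u) + (card (?N v) - 1))"
    using cB by (intro b_dR_le) auto
  then obtain m where m: "b_dR V E = enat m" "m \<le> card (?N u) + (card (?N v) - 1)"
    by (cases "b_dR V E") auto
  then show ?thesis
    using pos by (simp add: one_enat_def)
qed

section \<open>Bridges and forests\<close>

definition linked :: "'a set set \<Rightarrow> ('a \<times> 'a) set" where
  "linked H = {(x, y). {x, y} \<in> H}\<^sup>*"

definition bridge :: "'a set set \<Rightarrow> 'a set \<Rightarrow> bool" where
  "bridge H e \<longleftrightarrow> (\<exists>u v. e = {u, v} \<and> (u, v) \<notin> linked (H - {e}))"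

lemma linked_sym: "(u, v) \<in> linked H \<Longrightarrow> (v, u) \<in> linked H"
  unfolding linked_def
  by (rule symD[OF sym_rtrancl]) (auto simp: sym_def insert_commute)

lemma linked_mono: "H \<subseteq> H' \<Longrightarrow> linked H \<subseteq> linked H'"
  unfolding linked_def by (rule rtrancl_mono) auto

lemma linked_step: "(u, x) \<in> linked H \<Longrightarrow> {x, y} \<in> H \<Longrightarrow> (u, y) \<in> linked H"
  unfolding linked_def by (rule rtrancl_into_rtrancl) auto

lemma linked_refl: "(u, u) \<in> linked H"
  unfolding linked_def by simp

lemma bridge_iff: "bridge H {u, v} \<longleftrightarrow> (u, v) \<notin> linked (H - {{u, v}})"
  unfolding bridge_def using linked_sym by (fastforce simp: doubleton_eq_iff)

lemma bridge_mono: "bridge H e \<Longrightarrow> H' \<subseteq> H \<Longrightarrow> bridge H' e"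
  unfolding bridge_def using linked_mono[of "H' - {e}" "H - {e}"] by blast

lemma linked_first_edge:
  assumes "(u, v) \<in> linked H" "u \<noteq> v"
  obtains a where "{u, a} \<in> H"
  using assms unfolding linked_def by (auto elim: converse_rtranclE)

text \<open>Connects the two notions used for weights: faces are counted with bridges, whereas the
  discharging sees only vertices of degree 1.\<close>

lemma bridge_leaf:
  assumes sg: "simple_graph V E" and u: "card (neighbors E u) = 1" and uv: "{u, v} \<in> E"
  shows "bridge E {u, v}"
proof -
  have "neighbors E u = {v}"
    using u uv by (metis card_1_singletonE mem_Collect_eq neighbors_def singletonD)
  then have nb: "{u, a} \<in> E \<longleftrightarrow> a = v" for a
    by (auto simp: neighbors_def)
  have "v \<in> neighbors E u" using uv by (auto simp: neighbors_def)
  then have "u \<noteq> v" using simple_graph_neighbors[OF sg] by blast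
  show ?thesis
    unfolding bridge_iff
  proof
    assume "(u, v) \<in> linked (E - {{u, v}})"
    from linked_first_edge[OF this \<open>u \<noteq> v\<close>]
    obtain a where "{u, a} \<in> E - {{u, v}}" .
    then show False using nb[of a] by auto
  qed
qed

text \<open>\<open>X\<close> is what \<open>u\<close> still reaches without the bridge. An edge
  other than the bridge that touches \<open>X\<close> stays inside it, so the remaining edges fall
  into those within \<open>X\<close> and those disjoint from it.\<close>

lemma bridge_split:
  assumes H: "\<And>h. h \<in> H \<Longrightarrow> card h = 2" and e: "{u, v} \<in> H" "bridge H {u, v}"
  obtains H1 H2 X where "H = insert {u, v} (H1 \<union> H2)" "{u, v} \<notin> H1" "{u, v} \<notin> H2"
    "H1 \<inter> H2 = {}" "\<Union>H1 \<subseteq> X" "\<Union>H2 \<inter> X = {}" "u \<in> X" "v \<notin> X"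
proof
  define X where "X = {x. (u, x) \<in> linked (H - {{u, v}})}"
  define H1 where "H1 = {h \<in> H - {{u, v}}. h \<inter> X \<noteq> {}}"
  define H2 where "H2 = {h \<in> H - {{u, v}}. h \<inter> X = {}}"
  show "H = insert {u, v} (H1 \<union> H2)" "{u, v} \<notin> H1" "{u, v} \<notin> H2" "H1 \<inter> H2 = {}"
    using e by (auto simp: H1_def H2_def)
  show "u \<in> X" "v \<notin> X"
    using e(2) by (auto simp: X_def bridge_iff linked_refl)
  show "\<Union>H2 \<inter> X = {}"
    by (auto simp: H2_def)
  show "\<Union>H1 \<subseteq> X"
  proof (intro Union_least subsetI)
    fix h y assume h: "h \<in> H1" "y \<in> h"
    then obtain x where x: "x \<in> h" "x \<in> X" by (auto simp: H1_def)
    have hH: "h \<in> H - {{u, v}}" "card h = 2" using h H by (auto simp: H1_def)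
    show "y \<in> X"
    proof (cases "x = y")
      case False
      then have "h = {x, y}"
        using hH(2) h(2) x(1) by (auto simp: card_2_iff)
      then show ?thesis
        using linked_step[of u x _ y] x(2) hH(1) by (auto simp: X_def)
    qed (use x in simp)
  qed
qed

text \<open>A forest is described as an edge set all of whose members are bridges. Removing one
  bridge splits the vertices into two nonempty parts, each carrying a smaller forest by
  \<open>bridge_mono\<close>.\<close>

lemma forest_card_edges:
  assumes "finite V" "V \<noteq> {}" "\<And>h. h \<in> H \<Longrightarrow> h \<subseteq> V \<and> card h = 2" "\<And>h. h \<in> H \<Longrightarrow> bridge H h"
  shows "card H + 1 \<le> card V"
  using assms
proof (induction "card V" arbitrary: V H rule: less_induct)
  case less
  have finH: "finite H"
    using less.prems by (meson PowI finite_Pow_iff finite_subset subsetI)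
  show ?case
  proof (cases "H = {}")
    case True
    then show ?thesis using less.prems by (simp add: Suc_leI card_gt_0_iff)
  next
    case False
    then obtain e where "e \<in> H" by blast
    moreover obtain u v where "e = {u, v}"
      using less.prems(3)[OF \<open>e \<in> H\<close>] by (auto simp: card_2_iff)
    ultimately have uv: "{u, v} \<in> H" "bridge H {u, v}"
      using less.prems(4) by auto
    obtain H1 H2 X where sp: "H = insert {u, v} (H1 \<union> H2)" "{u, v} \<notin> H1" "{u, v} \<notin> H2"
      "H1 \<inter> H2 = {}" "\<Union>H1 \<subseteq> X" "\<Union>H2 \<inter> X = {}" "u \<in> X" "v \<notin> X"
      using bridge_split[OF _ uv] less.prems(3) by metis
    have sub: "H1 \<subseteq> H" "H2 \<subseteq> H" using sp(1) by auto
    have uvV: "u \<in> V" "v \<in> V" using less.prems(3) uv by auto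
    have cV: "card V = card (V \<inter> X) + card (V - X)"
      using less.prems(1) by (metis card_Int_Diff)
    have p1: "card (V \<inter> X) > 0" and p2: "card (V - X) > 0"
      using uvV sp less.prems(1) by (auto simp: card_gt_0_iff)
    have "card H1 + 1 \<le> card (V \<inter> X)"
    proof (rule less.hyps)
      show "bridge H1 h" if "h \<in> H1" for h
        using less.prems(4) bridge_mono[OF _ sub(1)] sub that by blast
      show "h \<subseteq> V \<inter> X \<and> card h = 2" if "h \<in> H1" for h
        using that less.prems(3)[of h] sub sp(5) by blast
    qed (use less.prems cV p1 p2 card_gt_0_iff in \<open>fastforce+\<close>)
    moreover have "card H2 + 1 \<le> card (V - X)"
    proof (rule less.hyps)
      show "bridge H2 h" if "h \<in> H2" for h
        using less.prems(4) bridge_mono[OF _ sub(2)] sub that by blast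
      show "h \<subseteq> V - X \<and> card h = 2" if "h \<in> H2" for h
        using that less.prems(3)[of h] sub sp(6) by blast
    qed (use less.prems cV p1 p2 card_gt_0_iff in \<open>fastforce+\<close>)
    moreover have "card H = card H1 + card H2 + 1"
      using sp finH by (simp add: card_Un_disjoint)
    ultimately show ?thesis using cV by linarith
  qed
qed

text \<open>A connection between the ends of \<open>e\<close> that avoids \<open>e\<close> leaves
  each end by another edge, and these two edges are distinct. If there are no further edges, they
  must share their other end, which closes a triangle.\<close>

lemma nonbridge_card_edges:
  assumes "finite H" "\<And>h. h \<in> H \<Longrightarrow> card h = 2" "e \<in> H" "\<not> bridge H e"
  shows "card H \<ge> 3"
    and "card H = 3 \<Longrightarrow> \<exists>u v a. u \<noteq> v \<and> u \<noteq> a \<and> v \<noteq> a \<and> H = {{u, v}, {u, a}, {v, a}}"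
proof -
  obtain u v where uv: "e = {u, v}" "u \<noteq> v"
    using assms(2)[OF assms(3)] by (auto simp: card_2_iff)
  then have l: "(u, v) \<in> linked (H - {e})" 
    using assms(4) bridge_iff[of H u v] by auto
  obtain a where a: "{u, a} \<in> H - {e}" using linked_first_edge[OF l uv(2)] .
  obtain b where b: "{v, b} \<in> H - {e}" using linked_first_edge[OF linked_sym[OF l] uv(2)[symmetric]] .
  have ne: "a \<noteq> v" "b \<noteq> u" "u \<noteq> a" "v \<noteq> b"
    using a b uv assms(2)[of "{u, a}"] assms(2)[of "{v, b}"] by (auto simp: insert_commute)
  then have d: "{u, v} \<noteq> {u, a}" "{u, v} \<noteq> {v, b}" "{u, a} \<noteq> {v, b}"
    using uv by (auto simp: doubleton_eq_iff)
  then have c3: "card {{u, v}, {u, a}, {v, b}} = 3" by simp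
  have sub: "{{u, v}, {u, a}, {v, b}} \<subseteq> H" using a b uv assms(3) by auto
  show "card H \<ge> 3" using card_mono[OF assms(1) sub] c3 by simp
  assume "card H = 3"
  then have H: "H = {{u, v}, {u, a}, {v, b}}"
    using card_subset_eq[OF assms(1) sub] c3 by simp
  have "a = b"
  proof (rule ccontr)
    assume "a \<noteq> b"
    \<comment> \<open>For distinct \<open>a\<close> and \<open>b\<close>, the two edges other than
      \<open>e\<close> are disjoint, so \<open>u\<close> reaches only \<open>a\<close>.\<close>
    have "x \<in> {u, a}" if "(u, x) \<in> linked (H - {e})" for x
      using that unfolding linked_def
    proof (induction rule: rtrancl_induct)
      case (step y z)
      then show ?case using \<open>a \<noteq> b\<close> ne uv H by (auto simp: doubleton_eq_iff)
    qed simp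
    from this[OF l] show False using ne uv by auto
  qed
  then show "\<exists>u v a. u \<noteq> v \<and> u \<noteq> a \<and> v \<noteq> a \<and> H = {{u, v}, {u, a}, {v, a}}"
    using H ne uv by blast
qed

section \<open>Plane drawings and their faces\<close>

lemma components_eqI:
  assumes "F \<in> components S" "F' \<in> components S" "y \<in> F" "z \<in> F'" "connected_component S y z"
  shows "F = F'"
  using assms by (metis components_iff connected_component_eq mem_Collect_eq)

locale plane_graph =
  fixes V :: "'a set" and E :: "'a set set"
    and p :: "'a \<Rightarrow> complex" and g :: "'a set \<Rightarrow> real \<Rightarrow> complex"
  assumes simple: "simple_graph V E" and drawing: "plane_drawing V E p g"
begin

definition skeleton :: "'a set set \<Rightarrow> complex set" where
  "skeleton H = (\<Union>e\<in>H. path_image (g e))"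

definition open_edge :: "'a set \<Rightarrow> complex set" where
  "open_edge e = path_image (g e) - p ` e"

text \<open>The end points of an edge are left out because a vertex on the frontier of
  \<open>F\<close> may carry edges that do not border \<open>F\<close>.\<close>

definition boundary :: "'a set set \<Rightarrow> complex set \<Rightarrow> 'a set set" where
  "boundary H F = {e \<in> H. open_edge e \<inter> closure F \<noteq> {}}"

lemma finite_edges: "H \<subseteq> E \<Longrightarrow> finite H"
  using simple_graph_finite_edges[OF simple] finite_subset by blast

lemma edge_card: "e \<in> E \<Longrightarrow> card e = 2" and edge_subset: "e \<in> E \<Longrightarrow> e \<subseteq> V"
  using simple by (auto simp: simple_graph_def)

lemma edge_arc: "e \<in> E \<Longrightarrow> arc (g e)"
  and edge_ends: "e \<in> E \<Longrightarrow> {pathstart (g e), pathfinish (g e)} = p ` e"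
  and edge_vertices: "e \<in> E \<Longrightarrow> path_image (g e) \<inter> p ` V = p ` e"
  and edges_meet: "e \<in> E \<Longrightarrow> e' \<in> E \<Longrightarrow> e \<noteq> e' \<Longrightarrow> path_image (g e) \<inter> path_image (g e') = p ` (e \<inter> e')"
  using drawing unfolding plane_drawing_def by auto

lemma compact_skeleton: "H \<subseteq> E \<Longrightarrow> compact (skeleton H)"
  unfolding skeleton_def
  by (intro compact_UN finite_edges compact_arc_image edge_arc) auto

lemma closed_skeleton: "H \<subseteq> E \<Longrightarrow> closed (skeleton H)"
  using compact_skeleton compact_imp_closed by blast

lemma skeleton_insert: "skeleton (insert e H) = path_image (g e) \<union> skeleton H"
  and skeleton_Un: "skeleton (H \<union> H') = skeleton H \<union> skeleton H'"
  by (auto simp: skeleton_def)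

lemma skeleton_remove: "e \<in> H \<Longrightarrow> skeleton H = path_image (g e) \<union> skeleton (H - {e})"
  by (auto simp: skeleton_def)

lemma open_edge_image:
  assumes "e \<in> E"
  shows "open_edge e = g e ` {0<..<1}"
  unfolding open_edge_def edge_ends[OF assms, symmetric]
  using simple_path_endless[OF arc_imp_simple_path[OF edge_arc[OF assms]]] .

lemma open_edge_nonempty: "e \<in> E \<Longrightarrow> open_edge e \<noteq> {}"
  by (simp add: open_edge_image)

lemma connected_open_edge: "e \<in> E \<Longrightarrow> connected (open_edge e)"
  unfolding open_edge_def using edge_ends[of e]
    connected_simple_path_endless[OF arc_imp_simple_path[OF edge_arc[of e]]] by simp

lemma open_edge_disjoint: "e \<in> E \<Longrightarrow> e' \<in> E \<Longrightarrow> e \<noteq> e' \<Longrightarrow> open_edge e \<inter> path_image (g e') = {}"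
  using edges_meet[of e e'] unfolding open_edge_def by blast

lemma open_edge_subset_Compl:
  assumes "H \<subseteq> E" "e \<in> E"
  shows "open_edge e \<subseteq> - skeleton (H - {e})"
  using open_edge_disjoint assms unfolding skeleton_def by blast

text \<open>The open part of an edge is nonempty and disjoint from all other edges, so a point set
  determines the edges that it is made of.\<close>

lemma skeleton_subset_imp:
  assumes "H \<subseteq> E" "H' \<subseteq> E" "skeleton H \<subseteq> skeleton H'"
  shows "H \<subseteq> H'"
proof
  fix e assume e: "e \<in> H"
  show "e \<in> H'"
  proof (rule ccontr)
    assume "e \<notin> H'"
    then have "open_edge e \<inter> skeleton H' = {}"
      using open_edge_subset_Compl[of H' e] assms e by auto
    moreover have "open_edge e \<subseteq> skeleton H"
      using e by (auto simp: open_edge_def skeleton_def)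
    ultimately show False
      using assms e open_edge_nonempty[of e] by blast
  qed
qed

text \<open>
  Janiszewski's theorem: the two sides of a bridge meet the bridge in at most one point each.
\<close>

lemma connected_component_bridge:
  assumes "H \<subseteq> E"
    and split: "H = insert {u, v} (H1 \<union> H2)" "{u, v} \<notin> H1" "{u, v} \<notin> H2"
      "\<Union>H1 \<subseteq> X" "\<Union>H2 \<inter> X = {}" "u \<in> X" "v \<notin> X"
    and y: "y \<notin> skeleton H" "z \<notin> skeleton H"
    and 1: "connected_component (- skeleton H1) y z" and 2: "connected_component (- skeleton H2) y z"
  shows "connected_component (- skeleton H) y z"
proof -
  have sub: "H1 \<subseteq> E" "H2 \<subseteq> E" "{u, v} \<in> E" using assms(1) split(1) by auto
  let ?e = "path_image (g {u, v})"
  \<comment> \<open>A single arc does not separate the plane.\<close>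
  have ce: "connected_component (- ?e) y z"
    using y split(1) connected_arc_complement[OF edge_arc[OF sub(3)]]
    by (auto simp: skeleton_insert connected_iff_connected_component)
  have m1: "?e \<inter> path_image (g h) \<subseteq> {p u}" if "h \<in> H1" for h
    using edges_meet[OF sub(3), of h] sub that split by blast
  have m2: "?e \<inter> path_image (g h) \<subseteq> {p v}" if "h \<in> H2" for h
    using edges_meet[OF sub(3), of h] sub that split by blast
  have m12: "path_image (g h) \<inter> path_image (g h') = {}" if "h \<in> H1" "h' \<in> H2" for h h'
  proof -
    have "h \<inter> h' = {}" using that split by blast
    moreover have "h \<noteq> {}" using that sub edge_card[of h] by auto
    ultimately have "h \<noteq> h'" by auto
    then have "path_image (g h) \<inter> path_image (g h') = p ` (h \<inter> h')"
      using that sub by (intro edges_meet) auto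
    then show ?thesis using \<open>h \<inter> h' = {}\<close> by simp
  qed
  have "connected_component (- (?e \<union> skeleton H1)) y z"
  proof (rule Janiszewski)
    have "?e \<inter> skeleton H1 \<subseteq> {p u}" using m1 unfolding skeleton_def by blast
    then show "connected (?e \<inter> skeleton H1)" by (auto simp: subset_singleton_iff)
  qed (use 1 ce sub closed_skeleton compact_arc_image[OF edge_arc] in auto)
  then have "connected_component (- ((?e \<union> skeleton H1) \<union> skeleton H2)) y z"
  proof (rule Janiszewski[rotated 3])
    have "(?e \<union> skeleton H1) \<inter> skeleton H2 \<subseteq> {p v}"
      using m2 m12 unfolding skeleton_def by blast
    then show "connected ((?e \<union> skeleton H1) \<inter> skeleton H2)" by (auto simp: subset_singleton_iff)
  qed (use 2 sub closed_skeleton compact_skeleton compact_arc_image[OF edge_arc] in auto)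
  then show ?thesis
    unfolding split(1) by (simp add: skeleton_insert skeleton_Un Un_assoc)
qed

text \<open>Induction on the number of edges: the two sides of a bridge are smaller forests with
  connected complements, and \<open>connected_component_bridge\<close> combines them.\<close>

lemma forest_connected_Compl:
  assumes "H \<subseteq> E" "\<And>h. h \<in> H \<Longrightarrow> bridge H h"
  shows "connected (- skeleton H)"
  using assms
proof (induction "card H" arbitrary: H rule: less_induct)
  case less
  show ?case
  proof (cases "H = {}")
    case True
    then show ?thesis by (simp add: skeleton_def connected_UNIV)
  next
    case False
    then obtain e where "e \<in> H" by blast
    moreover obtain u v where "e = {u, v}"
      using edge_card[of e] \<open>e \<in> H\<close> less.prems(1) by (auto simp: card_2_iff)
    ultimately have uv: "{u, v} \<in> H" "bridge H {u, v}"
      using less.prems(2) by auto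
    have "\<And>h. h \<in> H \<Longrightarrow> card h = 2" using edge_card less.prems(1) by blast
    from bridge_split[OF this uv]
    obtain H1 H2 X where sp: "H = insert {u, v} (H1 \<union> H2)" "{u, v} \<notin> H1" "{u, v} \<notin> H2"
      "H1 \<inter> H2 = {}" "\<Union>H1 \<subseteq> X" "\<Union>H2 \<inter> X = {}" "u \<in> X" "v \<notin> X" .
    have sub: "H1 \<subset> H" "H2 \<subset> H" using sp by auto
    have IH: "connected (- skeleton H')" if "H' \<subset> H" for H'
    proof (rule less.hyps)
      show "card H' < card H" using psubset_card_mono[OF finite_edges[OF less.prems(1)] that] .
      show "H' \<subseteq> E" using that less.prems by blast
      show "bridge H' h" if "h \<in> H'" for h
        using bridge_mono[OF less.prems(2)] that \<open>H' \<subset> H\<close> by blast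
    qed
    have c: "connected_component (- skeleton H') y z"
      if "H' \<subset> H" "y \<notin> skeleton H" "z \<notin> skeleton H" for y z H'
    proof -
      have "y \<notin> skeleton H'" "z \<notin> skeleton H'"
        using that by (auto simp: skeleton_def)
      then show ?thesis
        using IH[OF that(1)] by (auto simp: connected_iff_connected_component)
    qed
    show ?thesis
      unfolding connected_iff_connected_component
      using connected_component_bridge[OF less.prems(1) sp(1-3) sp(5-8)] c[OF sub(1)] c[OF sub(2)]
      by auto
  qed
qed

text \<open>Erasing \<open>e\<close> joins its open part to every face at \<open>e\<close>: the two
  connected sets are glued at a point of the open edge in the closure of \<open>F\<close>. In
  particular all faces at \<open>e\<close> merge.\<close>

lemma connected_component_incident_face:
  assumes "H \<subseteq> E" "e \<in> boundary H F" "F \<in> components (- skeleton H)" "y \<in> F" "x \<in> open_edge e"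
  shows "connected_component (- skeleton (H - {e})) x y"
proof -
  obtain z where z: "z \<in> open_edge e" "z \<in> closure F" "e \<in> H"
    using assms(2) by (auto simp: boundary_def)
  have "connected (insert z F)"
    by (rule connected_intermediate_closure[of F])
      (use z closure_subset in_components_connected[OF assms(3)] in auto)
  then have "connected (open_edge e \<union> insert z F)"
    using z assms(1) connected_open_edge by (intro connected_Un) auto
  moreover have "open_edge e \<union> insert z F \<subseteq> - skeleton (H - {e})"
  proof -
    have "F \<subseteq> - skeleton H" by (rule in_components_subset[OF assms(3)])
    then have "F \<subseteq> - skeleton (H - {e})" by (auto simp: skeleton_def)
    moreover have "open_edge e \<subseteq> - skeleton (H - {e})"
      using z assms(1) by (intro open_edge_subset_Compl) auto
    ultimately show ?thesis using z by auto
  qed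
  ultimately show ?thesis
    unfolding connected_component_def using assms by blast
qed

text \<open>Two faces at \<open>e\<close> merge once \<open>e\<close> is erased, so neither side of
  the bridge alone separates them. By \<open>connected_component_bridge\<close>, neither does
  \<open>H\<close>.\<close>

lemma bridge_one_face:
  assumes "H \<subseteq> E" "e \<in> H" "bridge H e"
    and F: "F \<in> components (- skeleton H)" "e \<in> boundary H F"
    and F': "F' \<in> components (- skeleton H)" "e \<in> boundary H F'"
  shows "F = F'"
proof -
  have eE: "e \<in> E" using assms by auto
  obtain u v where e: "e = {u, v}"
    using edge_card[OF eE] by (auto simp: card_2_iff)
  have "\<And>h. h \<in> H \<Longrightarrow> card h = 2" using edge_card assms(1) by blast
  from bridge_split[OF this assms(2,3)[unfolded e]]
  obtain H1 H2 X where sp: "H = insert {u, v} (H1 \<union> H2)" "{u, v} \<notin> H1" "{u, v} \<notin> H2"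
    "H1 \<inter> H2 = {}" "\<Union>H1 \<subseteq> X" "\<Union>H2 \<inter> X = {}" "u \<in> X" "v \<notin> X" .
  obtain y where y: "y \<in> F" using in_components_nonempty[OF F(1)] by blast
  obtain z where z: "z \<in> F'" using in_components_nonempty[OF F'(1)] by blast
  obtain x where x: "x \<in> open_edge e" using open_edge_nonempty[OF eE] by blast
  have *: "connected_component (- skeleton (H - {e})) y z"
    using connected_component_incident_face[OF assms(1) F(2,1) y x]
      connected_component_incident_face[OF assms(1) F'(2,1) z x]
    by (meson connected_component_sym connected_component_trans)
  have "connected_component (- skeleton H') y z" if "H' \<subseteq> H - {e}" for H'
    by (rule connected_component_of_subset[OF *]) (use that in \<open>auto simp: skeleton_def\<close>)
  then have "connected_component (- skeleton H1) y z" "connected_component (- skeleton H2) y z"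
    using sp e by auto
  moreover have "y \<notin> skeleton H" "z \<notin> skeleton H"
    using in_components_subset F(1) F'(1) y z by auto
  ultimately have "connected_component (- skeleton H) y z"
    using connected_component_bridge[OF assms(1) sp(1-3) sp(5-8)] by blast
  then show ?thesis
    using components_eqI F(1) F'(1) y z by blast
qed

section \<open>Jordan curves through edges that are not bridges\<close>

lemma linked_path_component:
  assumes "H \<subseteq> E" "(u, v) \<in> linked H" "u \<noteq> v"
  shows "path_component (skeleton H) (p u) (p v)"
proof -
  have edge: "path_component (skeleton H) (p x) (p y)" if xy: "{x, y} \<in> H" for x y
  proof -
    have "{x, y} \<in> E" using xy assms(1) by auto
    then have "{p x, p y} \<subseteq> path_image (g {x, y})"
      using edge_vertices[of "{x, y}"] by auto
    moreover have "path_connected (path_image (g {x, y}))"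
      using edge_arc[OF \<open>{x, y} \<in> E\<close>] arc_imp_path path_connected_path_image by blast
    ultimately have "path_component (path_image (g {x, y})) (p x) (p y)"
      unfolding path_connected_component by auto
    then show ?thesis
      by (rule path_component_of_subset[rotated]) (use xy in \<open>auto simp: skeleton_def\<close>)
  qed
  have "u = v \<or> path_component (skeleton H) (p u) (p v)"
    using assms(2) unfolding linked_def
  proof (induction rule: rtrancl_induct)
    case (step y z)
    then show ?case using edge path_component_trans by blast
  qed simp
  then show ?thesis using assms(3) by simp
qed

text \<open>The ends of \<open>e\<close> are joined by an arc in the rest of the skeleton, which
  meets \<open>e\<close> only at these ends and so closes it to a simple curve. The arc
  \<open>A\<close> is kept in the conclusion because it is exactly where the curve meets the other
  edges, as Janiszewski's theorem requires.\<close>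

lemma nonbridge_Jordan_curve:
  assumes "H \<subseteq> E" "e \<in> H" "\<not> bridge H e"
  obtains c A where "simple_path c" "pathfinish c = pathstart c"
    "path_image c = path_image (g e) \<union> A" "A \<subseteq> skeleton (H - {e})" "connected A" "p ` e \<subseteq> A"
proof -
  have eE: "e \<in> E" using assms by auto
  obtain u v where e: "e = {u, v}" "u \<noteq> v"
    using edge_card[OF eE] by (auto simp: card_2_iff)
  have l: "(u, v) \<in> linked (H - {e})"
    using assms(3) bridge_iff[of H u v] e by simp
  have sub: "H - {e} \<subseteq> E" using assms by auto
  have *: "path_component (skeleton (H - {e})) (p u) (p v)" "path_component (skeleton (H - {e})) (p v) (p u)"
    using linked_path_component[OF sub l e(2)] path_component_sym by blast+
  let ?a = "pathstart (g e)" and ?b = "pathfinish (g e)"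
  have ab: "{?a, ?b} = {p u, p v}" using edge_ends[OF eE] e by simp
  then have "path_component (skeleton (H - {e})) ?b ?a"
    using * by (auto simp: doubleton_eq_iff)
  then obtain q where q: "path q" "path_image q \<subseteq> skeleton (H - {e})" "pathstart q = ?b" "pathfinish q = ?a"
    unfolding path_component_def by blast
  have "?b \<noteq> ?a"
    using arc_distinct_ends[OF edge_arc[OF eE]] by simp
  then obtain r where r: "arc r" "path_image r \<subseteq> path_image q" "pathstart r = ?b" "pathfinish r = ?a"
    using path_contains_arc[OF q(1,3,4)] by metis
  have rs: "path_image r \<subseteq> skeleton (H - {e})" using r q by blast
  have meet: "path_image (g e) \<inter> path_image r \<subseteq> p ` e"
    using open_edge_subset_Compl[OF assms(1) eE] rs unfolding open_edge_def by blast
  show ?thesis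
  proof
    show "simple_path (g e +++ r)"
      by (rule simple_path_join_loop) (use r edge_arc[OF eE] meet edge_ends[OF eE] in auto)
    show "pathfinish (g e +++ r) = pathstart (g e +++ r)" using r by simp
    show "path_image (g e +++ r) = path_image (g e) \<union> path_image r"
      by (rule path_image_join) (use r in simp)
    show "path_image r \<subseteq> skeleton (H - {e})" by fact
    show "connected (path_image r)" using r(1) arc_imp_path connected_path_image by blast
    show "p ` e \<subseteq> path_image r"
      unfolding edge_ends[OF eE, symmetric] using r pathstart_in_path_image[of r] pathfinish_in_path_image[of r]
      by simp
  qed
qed

text \<open>
  The Jordan curve through a non-bridge meets the remaining edges in an arc, so Janiszewski's
  theorem bounds the faces at the edge by the two sides of the curve.
\<close>

lemma nonbridge_two_faces:
  assumes "H \<subseteq> E" "e \<in> H" "\<not> bridge H e"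
  obtains F1 F2 where "{F \<in> components (- skeleton H). e \<in> boundary H F} \<subseteq> {F1, F2}"
proof -
  have eE: "e \<in> E" using assms by auto
  obtain c A where c: "simple_path c" "pathfinish c = pathstart c"
    "path_image c = path_image (g e) \<union> A" "A \<subseteq> skeleton (H - {e})" "connected A" "p ` e \<subseteq> A"
    using nonbridge_Jordan_curve[OF assms] .
  let ?T = "{F \<in> components (- skeleton H). e \<in> boundary H F}"
  obtain x where x: "x \<in> open_edge e" using open_edge_nonempty[OF eE] by blast
  have HH: "skeleton H = path_image c \<union> skeleton (H - {e})"
    using c(3,4) skeleton_remove[OF assms(2)] by blast
  \<comment> \<open>Two faces at \<open>e\<close> that meet a common connected set off the curve
    coincide: \<open>S\<close> joins them off the curve, the open part of \<open>e\<close> joins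
    them off the other edges, and curve and other edges meet in the connected set
    \<open>A\<close>.\<close>
  have eq: "F = F'"
    if F: "F \<in> ?T" "F' \<in> ?T" and S: "connected S" "S \<subseteq> - path_image c"
      "F \<inter> S \<noteq> {}" "F' \<inter> S \<noteq> {}" for F F' S
  proof -
    obtain y z where y: "y \<in> F" "y \<in> S" and z: "z \<in> F'" "z \<in> S" using S by blast
    have *: "connected_component (- skeleton (H - {e})) y z"
      using connected_component_incident_face[OF assms(1) _ _ y(1) x]
        connected_component_incident_face[OF assms(1) _ _ z(1) x] F
      by (metis (no_types, lifting) connected_component_sym connected_component_trans mem_Collect_eq)
    have "connected_component (- (path_image c \<union> skeleton (H - {e}))) y z"
    proof (rule Janiszewski)
      have "path_image c \<inter> skeleton (H - {e}) = A"
        using c(3,4,6) open_edge_subset_Compl[OF assms(1) eE] unfolding open_edge_def by blast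
      then show "connected (path_image c \<inter> skeleton (H - {e}))" using c(5) by simp
      show "compact (path_image c)" using c(1) compact_simple_path_image by blast
      show "closed (skeleton (H - {e}))" using assms closed_skeleton by blast
      show "connected_component (- path_image c) y z"
        unfolding connected_component_def using S y z by blast
    qed (rule *)
    then show ?thesis
      using components_eqI[of F "- skeleton H" F' y z] F y z HH by auto
  qed
  note J = Jordan_inside_outside[OF c(1,2)]
  have meets: "F \<inter> inside (path_image c) \<noteq> {} \<or> F \<inter> outside (path_image c) \<noteq> {}" if FT: "F \<in> ?T" for F
  proof -
    obtain y where "y \<in> F" using FT in_components_nonempty by blast
    moreover have "y \<notin> path_image c"
      using FT \<open>y \<in> F\<close> in_components_subset[of F] HH by blast
    ultimately show ?thesis using J by blast
  qed
  have "\<exists>F1. \<forall>F\<in>?T. F \<inter> S \<noteq> {} \<longrightarrow> F = F1" if "connected S" "S \<subseteq> - path_image c" for S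
    using eq[OF _ _ that] by (metis (no_types, lifting))
  moreover have "inside (path_image c) \<subseteq> - path_image c" "outside (path_image c) \<subseteq> - path_image c"
    using J by blast+
  ultimately obtain F1 F2 where F12: "\<forall>F\<in>?T. F \<inter> inside (path_image c) \<noteq> {} \<longrightarrow> F = F1"
    "\<forall>F\<in>?T. F \<inter> outside (path_image c) \<noteq> {} \<longrightarrow> F = F2"
    using J by presburger
  have "?T \<subseteq> {F1, F2}"
  proof
    fix F assume "F \<in> ?T"
    with F12 meets[OF this] have "F = F1 \<or> F = F2" by metis
    then show "F \<in> {F1, F2}" by simp
  qed
  then show ?thesis by (rule that)
qed

text \<open>A small ball around an interior point of \<open>e\<close> avoids all other edges, yet
  contains points inside and outside the Jordan curve through \<open>e\<close>. The ball joins them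
  when \<open>e\<close> is erased; the curve, part of the skeleton of \<open>H\<close>, separates
  them.\<close>

lemma nonbridge_splits_face:
  assumes "H \<subseteq> E" "e \<in> H" "\<not> bridge H e"
  obtains y z where "y \<notin> skeleton H" "z \<notin> skeleton H"
    "connected_component (- skeleton (H - {e})) y z" "\<not> connected_component (- skeleton H) y z"
proof -
  have eE: "e \<in> E" using assms by auto
  obtain c A where c: "simple_path c" "pathfinish c = pathstart c"
    "path_image c = path_image (g e) \<union> A" "A \<subseteq> skeleton (H - {e})" "connected A" "p ` e \<subseteq> A"
    using nonbridge_Jordan_curve[OF assms] .
  note J = Jordan_inside_outside[OF c(1,2)]
  obtain x where x: "x \<in> open_edge e" using open_edge_nonempty[OF eE] by blast
  have "x \<notin> skeleton (H - {e})" using x open_edge_subset_Compl[OF assms(1) eE] by blast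
  moreover have "open (- skeleton (H - {e}))" using assms closed_skeleton[of "H - {e}"] by auto
  ultimately obtain r where r: "r > 0" "ball x r \<subseteq> - skeleton (H - {e})"
    using openE by blast
  have xc: "x \<in> path_image c" using x c(3) by (auto simp: open_edge_def)
  have "x \<in> closure (inside (path_image c))" "x \<in> closure (outside (path_image c))"
    using xc J by (auto simp: frontier_def)
  then obtain y z where y: "y \<in> inside (path_image c)" "y \<in> ball x r"
    and z: "z \<in> outside (path_image c)" "z \<in> ball x r"
    using r(1) unfolding closure_approachable by (metis dist_commute mem_ball)
  have HH: "skeleton H = path_image c \<union> skeleton (H - {e})"
    using c(3,4) skeleton_remove[OF assms(2)] by blast
  show ?thesis
  proof
    show "y \<notin> skeleton H" "z \<notin> skeleton H" using y z r(2) J unfolding HH by blast+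
    show "connected_component (- skeleton (H - {e})) y z"
      unfolding connected_component_def using y z r(2) connected_ball by blast
    show "\<not> connected_component (- skeleton H) y z"
    proof
      assume "connected_component (- skeleton H) y z"
      then have "connected_component (- path_image c) y z"
        by (rule connected_component_of_subset) (use HH in auto)
      then obtain T where T: "connected T" "T \<subseteq> - path_image c" "y \<in> T" "z \<in> T"
        unfolding connected_component_def by blast
      have "inside (path_image c) \<inter> T = {} \<or> outside (path_image c) \<inter> T = {}"
        using connectedD[OF T(1), of "inside (path_image c)" "outside (path_image c)"] J T(2) by blast
      then show False using y z T by blast
    qed
  qed
qed

text \<open>The delicate case is a frontier point \<open>z\<close> at a vertex that lies on no
  boundary edge. A small punctured disc around \<open>z\<close> would then contain no frontier point
  and so lie in \<open>F\<close>, although an edge ending at \<open>z\<close> enters it.\<close>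

lemma frontier_subset_boundary:
  assumes "H \<subseteq> E" "F \<in> components (- skeleton H)"
  shows "frontier F \<subseteq> skeleton (boundary H F)"
proof
  fix z assume z: "z \<in> frontier F"
  have oF: "open F"
    using assms open_components[of "- skeleton H" F] closed_skeleton by blast
  have fr: "frontier F \<subseteq> skeleton H"
    using frontier_of_components_closed_complement[OF closed_skeleton assms(2)] assms(1) by blast
  have finH: "finite H" by (rule finite_edges[OF assms(1)])
  show "z \<in> skeleton (boundary H F)"
  proof (rule ccontr)
    assume nz: "z \<notin> skeleton (boundary H F)"
    have vert: "q \<in> p ` h" if "q \<in> frontier F" "q \<in> path_image (g h)" "h \<in> H" "h \<notin> boundary H F" for q h
      using that unfolding boundary_def open_edge_def frontier_def by blast
    obtain e where e: "e \<in> H" "z \<in> path_image (g e)" using z fr by (auto simp: skeleton_def)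
    then have eb: "e \<notin> boundary H F" using nz by (auto simp: skeleton_def)
    have zp: "z \<in> p ` V" using vert[OF z e(2,1) eb] edge_subset assms(1) e by blast
    \<comment> \<open>\<open>D\<close> consists of the edges that miss \<open>z\<close> and of the
      other vertices. A disc off \<open>D\<close> can meet the frontier of \<open>F\<close> only at
      \<open>z\<close>.\<close>
    define D where "D = skeleton {h \<in> H. z \<notin> path_image (g h)} \<union> (p ` V - {z})"
    have "closed D"
      unfolding D_def using simple assms(1)
      by (intro closed_Un closed_skeleton finite_imp_closed) (auto simp: simple_graph_def)
    moreover have "z \<notin> D" by (auto simp: D_def skeleton_def)
    ultimately obtain r where r: "r > 0" "ball z r \<subseteq> - D"
      by (metis ComplI open_Compl openE)
    have "(ball z r - {z}) \<inter> frontier F = {}"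
    proof (rule ccontr)
      assume "(ball z r - {z}) \<inter> frontier F \<noteq> {}"
      then obtain q where q: "q \<in> ball z r" "q \<noteq> z" "q \<in> frontier F" by blast
      then obtain h where h: "h \<in> H" "q \<in> path_image (g h)" using fr by (auto simp: skeleton_def)
      then have "z \<in> path_image (g h)" using q r by (auto simp: D_def skeleton_def)
      then have "h \<notin> boundary H F" using nz by (auto simp: skeleton_def)
      then have "q \<in> p ` V" using vert[OF q(3) h(2,1)] edge_subset h assms(1) by blast
      then show False using q r by (auto simp: D_def)
    qed
    moreover have "connected (ball z r - {z})"
      by (rule connected_punctured_ball) simp
    moreover have "(ball z r - {z}) \<inter> F \<noteq> {}"
    proof -
      have "z \<notin> F" "z \<in> closure F" using z oF by (auto simp: frontier_def interior_open)
      then obtain y where "y \<in> F" "dist y z < r" using r(1) unfolding closure_approachable by blast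
      then have "y \<in> (ball z r - {z}) \<inter> F" using \<open>z \<notin> F\<close> by (auto simp: dist_commute)
      then show ?thesis by blast
    qed
    ultimately have "ball z r - {z} \<subseteq> F"
      using connected_Int_frontier[of "ball z r - {z}" F] by blast
    moreover have "\<exists>y\<in>path_image (g e). y \<in> ball z r \<and> y \<noteq> z"
    proof -
      have a: "arc (g e)" using edge_arc e assms(1) by blast
      have "path_image (g e) \<noteq> {x}" for x
        using arc_distinct_ends[OF a] pathstart_in_path_image[of "g e"] pathfinish_in_path_image[of "g e"] by auto
      then have "z islimpt path_image (g e)"
        by (intro connected_imp_perfect) (use e a in \<open>auto intro: connected_arc_image\<close>)
      then show ?thesis
        using r(1) unfolding islimpt_approachable by (metis dist_commute mem_ball)
    qed
    moreover have "path_image (g e) \<inter> F = {}"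
      using in_components_subset[OF assms(2)] e(1) by (auto simp: skeleton_def)
    ultimately show False by blast
  qed
qed

text \<open>A connected set avoiding the boundary edges avoids the frontier of \<open>F\<close>, so
  it cannot extend \<open>F\<close>.\<close>

lemma face_of_boundary:
  assumes "H \<subseteq> E" "F \<in> components (- skeleton H)"
  shows "F \<in> components (- skeleton (boundary H F))"
proof -
  have F: "connected F" "F \<noteq> {}" "F \<subseteq> - skeleton H"
    using assms(2) in_components_connected in_components_nonempty in_components_subset by blast+
  have F': "F \<subseteq> - skeleton (boundary H F)"
    using F(3) by (auto simp: skeleton_def boundary_def)
  show ?thesis
    unfolding in_components_maximal
  proof (intro conjI allI impI)
    fix D assume D: "D \<noteq> {} \<and> F \<subseteq> D \<and> D \<subseteq> - skeleton (boundary H F) \<and> connected D"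
    then have "D \<inter> frontier F = {}"
      using frontier_subset_boundary[OF assms] by blast
    then show "D = F"
      using connected_Int_frontier[of D F] D F(2) by blast
  qed (use F F' in auto)
qed

lemma boundary_nonempty:
  assumes "H \<subseteq> E" "H \<noteq> {}" "F \<in> components (- skeleton H)"
  shows "boundary H F \<noteq> {}"
proof
  assume "boundary H F = {}"
  then have "F \<in> components UNIV"
    using face_of_boundary[OF assms(1,3)] by (simp add: skeleton_def)
  then have "F = UNIV"
    by (metis components_UNIV UNIV_not_empty connected_UNIV singletonD)
  then have "skeleton H = {}"
    using in_components_subset[OF assms(3)] by auto
  then show False
    using skeleton_subset_imp[of H "{}"] assms by auto
qed

section \<open>Counting faces and Euler's inequality\<close>

lemma finite_incident_faces:
  assumes "H \<subseteq> E" "e \<in> H"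
  shows "finite {F \<in> components (- skeleton H). e \<in> boundary H F}"
proof (cases "bridge H e")
  case True
  have "\<exists>F1. {F \<in> components (- skeleton H). e \<in> boundary H F} \<subseteq> {F1}"
    using bridge_one_face[OF assms True] by blast
  then show ?thesis using finite_subset by blast
next
  case False
  then show ?thesis using nonbridge_two_faces[OF assms False] finite_subset by (metis finite.simps)
qed

lemma finite_faces:
  assumes "H \<subseteq> E"
  shows "finite (components (- skeleton H))"
proof (cases "H = {}")
  case True
  then show ?thesis by (simp add: skeleton_def components_UNIV)
next
  case False
  have "components (- skeleton H) = (\<Union>e\<in>H. {F \<in> components (- skeleton H). e \<in> boundary H F})"
  proof -
    have "\<exists>e\<in>H. e \<in> boundary H F" if "F \<in> components (- skeleton H)" for F
      using boundary_nonempty[OF assms False that] by (auto simp: boundary_def)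
    then show ?thesis by blast
  qed
  then show ?thesis
    using finite_incident_faces[OF assms] finite_edges[OF assms] by (metis (no_types, lifting) finite_UN)
qed

text \<open>Sending each face of \<open>H\<close> to the face of \<open>H - {e}\<close> that
  contains it is surjective, but not injective by \<open>nonbridge_splits_face\<close>.\<close>

lemma nonbridge_card_faces:
  assumes "H \<subseteq> E" "e \<in> H" "\<not> bridge H e"
  shows "card (components (- skeleton (H - {e}))) < card (components (- skeleton H))"
proof -
  let ?K = "- skeleton H" and ?L = "- skeleton (H - {e})"
  have sub: "?K \<subseteq> ?L" by (auto simp: skeleton_def)
  from nonbridge_splits_face[OF assms]
  obtain y z where yz: "y \<in> ?K" "z \<in> ?K" "connected_component ?L y z" "\<not> connected_component ?K y z"
    unfolding Compl_iff .
  \<comment> \<open>The chosen point is immaterial: all points of a face of \<open>H\<close> lie in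
    the same component of \<open>?L\<close>.\<close>
  define h where "h F = connected_component_set ?L (SOME x. x \<in> F)" for F
  have h: "h F = connected_component_set ?L x" if "F \<in> components ?K" "x \<in> F" for F x
  proof -
    have "(SOME x. x \<in> F) \<in> F" using that by (meson someI)
    then have "connected_component ?K (SOME x. x \<in> F) x"
      using that in_components_connected[OF that(1)] in_components_subset[OF that(1)]
      unfolding connected_component_def by blast
    then have "connected_component ?L (SOME x. x \<in> F) x"
      using connected_component_of_subset sub by blast
    then show ?thesis unfolding h_def by (simp add: connected_component_eq)
  qed
  have Fx: "connected_component_set ?K x \<in> components ?K" "x \<in> connected_component_set ?K x" if "x \<in> ?K" for x
    using that by (auto simp: componentsI)
  have sup: "components ?L \<subseteq> h ` components ?K"
  proof
    fix D assume D: "D \<in> components ?L"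
    obtain x where x: "x \<in> D" "x \<in> ?K"
    proof (cases "D \<inter> path_image (g e) = {}")
      case True
      obtain x where "x \<in> D" using in_components_nonempty[OF D] by blast
      moreover have "x \<in> ?K"
        using True \<open>x \<in> D\<close> in_components_subset[OF D] by (auto simp: skeleton_def)
      ultimately show ?thesis using that by blast
    next
      case False
      have eE: "e \<in> E" using assms by auto
      obtain c A where c: "simple_path c" "pathfinish c = pathstart c"
        "path_image c = path_image (g e) \<union> A" "A \<subseteq> skeleton (H - {e})" "connected A" "p ` e \<subseteq> A"
        using nonbridge_Jordan_curve[OF assms] .
      \<comment> \<open>Surjectivity needs a point of \<open>D\<close> off \<open>e\<close>. The
        open set \<open>D\<close> meets the curve along \<open>e\<close>, hence also the inside of
        the curve, which \<open>e\<close> does not enter.\<close>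
      have "D \<inter> open_edge e \<noteq> {}"
        using False c(4,6) in_components_subset[OF D] unfolding open_edge_def by blast
      then obtain x where x: "x \<in> D" "x \<in> path_image (g e)" by (auto simp: open_edge_def)
      have "open D" using open_components[OF _ D] closed_skeleton[of "H - {e}"] assms(1) by auto
      moreover have "x \<in> closure (inside (path_image c))"
        using Jordan_inside_outside[OF c(1,2)] x(2) c(3) by (auto simp: frontier_def)
      ultimately have "D \<inter> inside (path_image c) \<noteq> {}"
        using x(1) open_Int_closure_eq_empty by blast
      moreover have "inside (path_image c) \<inter> path_image (g e) = {}"
        using inside_no_overlap[of "path_image c"] c(3) by blast
      ultimately obtain x where "x \<in> D" "x \<notin> path_image (g e)" by blast
      moreover have "x \<in> ?K"
        using calculation in_components_subset[OF D] by (auto simp: skeleton_def)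
      ultimately show ?thesis using that by blast
    qed
    then have "D = connected_component_set ?L x"
      using D by (metis components_iff connected_component_eq)
    then have "D = h (connected_component_set ?K x)" using h[OF Fx[OF x(2)]] by simp
    then show "D \<in> h ` components ?K" using Fx[OF x(2)] by blast
  qed
  have "\<not> inj_on h (components ?K)"
  proof
    assume inj: "inj_on h (components ?K)"
    have "h (connected_component_set ?K y) = h (connected_component_set ?K z)"
      using h[OF Fx[OF yz(1)]] h[OF Fx[OF yz(2)]] connected_component_eq yz(3) by (metis mem_Collect_eq)
    then have "connected_component_set ?K y = connected_component_set ?K z"
      using inj Fx yz by (auto dest: inj_onD)
    then show False using yz Fx(2)[OF yz(2)] by auto
  qed
  then have "card (h ` components ?K) < card (components ?K)"
    using finite_faces[OF assms(1)] card_image_le[of "components ?K" h] eq_card_imp_inj_on[of "components ?K" h]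
    by fastforce
  moreover have "card (components ?L) \<le> card (h ` components ?K)"
    using sup finite_faces[OF assms(1)] by (intro card_mono) auto
  ultimately show ?thesis by linarith
qed

text \<open>Deleting edges that are not bridges costs at least one face each, until a forest
  remains. It suffices there that some face exists. Disconnected graphs are covered because only
  this direction is claimed.\<close>

theorem Euler_inequality:
  assumes "H \<subseteq> E" "V \<noteq> {}"
  shows "card H + 2 \<le> card (components (- skeleton H)) + card V"
  using assms(1)
proof (induction "card H" arbitrary: H rule: less_induct)
  case less
  show ?case
  proof (cases "\<forall>h\<in>H. bridge H h")
    case True
    have "card H + 1 \<le> card V"
    proof (rule forest_card_edges)
      show "finite V" using simple by (simp add: simple_graph_def)
      show "h \<subseteq> V \<and> card h = 2" if "h \<in> H" for h
        using edge_card edge_subset less.prems that by blast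
    qed (use True assms(2) in auto)
    moreover have "- skeleton H \<noteq> {}"
      using compact_skeleton[OF less.prems] not_compact_UNIV
      by (metis Compl_eq_Diff_UNIV Diff_eq_empty_iff top.extremum_uniqueI)
    then have "components (- skeleton H) \<noteq> {}" by simp
    then have "card (components (- skeleton H)) > 0"
      using finite_faces[OF less.prems] by (simp add: card_gt_0_iff)
    ultimately show ?thesis by linarith
  next
    case False
    then obtain e where e: "e \<in> H" "\<not> bridge H e" by blast
    have "card H = card (H - {e}) + 1"
      using e finite_edges[OF less.prems] by (metis Suc_eq_plus1 card.remove)
    then show ?thesis
      using less.hyps[of "H - {e}"] nonbridge_card_faces[OF less.prems e] less.prems by fastforce
  qed
qed

text \<open>A forest does not separate the plane, so \<open>F\<close> is the whole complement of its
  boundary and leaves no room for further edges.\<close>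

lemma face_boundary_forest:
  assumes "H \<subseteq> E" "F \<in> components (- skeleton H)" "\<forall>h\<in>boundary H F. bridge (boundary H F) h"
  shows "boundary H F = H"
proof -
  have sub: "boundary H F \<subseteq> H" by (auto simp: boundary_def)
  have "connected (- skeleton (boundary H F))"
    using forest_connected_Compl[of "boundary H F"] sub assms by auto
  then have "F = - skeleton (boundary H F)"
    using face_of_boundary[OF assms(1,2)] by (metis components_empty components_eq_sing_iff emptyE singletonD)
  then have "skeleton H \<subseteq> skeleton (boundary H F)"
    using in_components_subset[OF assms(2)] by blast
  then show ?thesis
    using skeleton_subset_imp[of H "boundary H F"] assms sub by auto
qed

lemma card_boundary_ge_3:
  assumes "H \<subseteq> E" "F \<in> components (- skeleton H)" "card H \<ge> 3"
  shows "card (boundary H F) \<ge> 3"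
proof (cases "\<forall>h\<in>boundary H F. bridge (boundary H F) h")
  case True
  then show ?thesis using face_boundary_forest[OF assms(1,2)] assms(3) by simp
next
  case False
  have "boundary H F \<subseteq> H" by (auto simp: boundary_def)
  then show ?thesis
    using False nonbridge_card_edges(1)[of "boundary H F"] finite_edges edge_card assms(1)
    by (meson subset_trans subsetD)
qed

lemma boundary_triangle:
  assumes "F \<in> components (- skeleton E)" "card E \<ge> 4" "card (boundary E F) = 3"
  shows "\<exists>u v a. u \<noteq> v \<and> u \<noteq> a \<and> v \<noteq> a \<and> boundary E F = {{u, v}, {u, a}, {v, a}}"
    and "\<exists>e\<in>boundary E F. \<not> bridge (boundary E F) e"
proof -
  have "boundary E F \<subseteq> E" by (auto simp: boundary_def)
  show nb: "\<exists>e\<in>boundary E F. \<not> bridge (boundary E F) e"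
    using face_boundary_forest[OF _ assms(1)] assms by fastforce
  then show "\<exists>u v a. u \<noteq> v \<and> u \<noteq> a \<and> v \<noteq> a \<and> boundary E F = {{u, v}, {u, a}, {v, a}}"
    using nonbridge_card_edges(2)[of "boundary E F"] finite_edges edge_card \<open>boundary E F \<subseteq> E\<close> assms(3)
    by (meson subsetD)
qed

text \<open>Both faces remain faces of the triangle alone. Each face of the triangle has all three
  edges on its boundary, so there are at most two. Hence \<open>F\<close> and \<open>F'\<close> fill
  its complement, and no fourth edge fits.\<close>

lemma boundary_triangle_unique:
  assumes F: "F \<in> components (- skeleton E)" "card (boundary E F) = 3"
    and F': "F' \<in> components (- skeleton E)" "boundary E F' = boundary E F" and "card E \<ge> 4"
  shows "F = F'"
proof (rule ccontr)
  assume "F \<noteq> F'"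
  let ?T = "boundary E F"
  have T: "?T \<subseteq> E" by (auto simp: boundary_def)
  obtain e where e: "e \<in> ?T" "\<not> bridge ?T e"
    using boundary_triangle(2)[OF F(1) \<open>card E \<ge> 4\<close> F(2)] by blast
  have FT: "F \<in> components (- skeleton ?T)" "F' \<in> components (- skeleton ?T)"
    using face_of_boundary[of E F] face_of_boundary[of E F'] F F' by auto
  obtain F1 F2 where F12: "{D \<in> components (- skeleton ?T). e \<in> boundary ?T D} \<subseteq> {F1, F2}"
    using nonbridge_two_faces[OF T e] .
  have "e \<in> boundary ?T D" if "D \<in> components (- skeleton ?T)" for D
  proof -
    have "card ?T \<le> card (boundary ?T D)"
      using card_boundary_ge_3[OF T that] F(2) by simp
    moreover have "boundary ?T D \<subseteq> ?T" by (auto simp: boundary_def)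
    ultimately have "boundary ?T D = ?T"
      using card_seteq finite_edges[OF T] by blast
    then show ?thesis using e by simp
  qed
  then have F12': "components (- skeleton ?T) \<subseteq> {F1, F2}"
    using F12 by (simp add: subset_iff)
  then have "{F1, F2} = {F, F'}"
    using FT \<open>F \<noteq> F'\<close> by auto
  then have comps: "components (- skeleton ?T) \<subseteq> {F, F'}"
    using F12' by simp
  have "- skeleton ?T \<subseteq> - skeleton E"
  proof -
    have "- skeleton ?T = \<Union>(components (- skeleton ?T))" by (simp add: Union_components)
    also have "\<dots> \<subseteq> F \<union> F'" using comps by blast
    also have "\<dots> \<subseteq> - skeleton E" using in_components_subset F(1) F'(1) by blast
    finally show ?thesis .
  qed
  then have "E \<subseteq> ?T"
    using skeleton_subset_imp[of E ?T] T by blast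
  then have "card E \<le> 3"
    using card_mono[OF finite_edges[OF T]] F(2) by simp
  then show False using \<open>card E \<ge> 4\<close> by simp
qed

section \<open>Sharing faces among edges\<close>

definition common_neighbors :: "'a set \<Rightarrow> 'a set" where
  "common_neighbors e = {x. \<forall>y\<in>e. {y, x} \<in> E}"

lemma common_neighbors_pair: "common_neighbors {u, v} = neighbors E u \<inter> neighbors E v"
  by (auto simp: common_neighbors_def neighbors_def)

lemma finite_common_neighbors:
  assumes "e \<in> E"
  shows "finite (common_neighbors e)"
proof -
  obtain u v where "e = {u, v}"
    using edge_card[OF assms] by (auto simp: card_2_iff)
  then show ?thesis
    using simple_graph_finite_neighbors[OF simple] by (simp add: common_neighbors_pair)
qed

text \<open>The apex \<open>x\<close> determines the whole boundary from \<open>e\<close>, so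
  distinct triangular faces at \<open>e\<close> yield distinct common neighbours.\<close>

lemma boundary_triangle_apex:
  assumes "F \<in> components (- skeleton E)" "card E \<ge> 4" "card (boundary E F) = 3" "e \<in> boundary E F"
  obtains x where "x \<in> common_neighbors e" "boundary E F = insert e ((\<lambda>y. {y, x}) ` e)"
proof -
  obtain u v a where t: "u \<noteq> v" "u \<noteq> a" "v \<noteq> a" "boundary E F = {{u, v}, {u, a}, {v, a}}"
    using boundary_triangle(1)[OF assms(1-3)] by blast
  moreover have "boundary E F \<subseteq> E" by (auto simp: boundary_def)
  ultimately have inE: "{u, v} \<in> E" "{u, a} \<in> E" "{v, a} \<in> E" by auto
  consider "e = {u, v}" | "e = {u, a}" | "e = {v, a}" using t assms(4) by auto
  then show ?thesis
  proof cases
    case 1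
    then show ?thesis using that[of a] t inE by (auto simp: common_neighbors_def)
  next
    case 2
    then show ?thesis using that[of v] t inE by (auto simp: common_neighbors_def insert_commute)
  next
    case 3
    then show ?thesis using that[of u] t inE by (auto simp: common_neighbors_def insert_commute)
  qed
qed

definition face_share :: "'a set \<Rightarrow> real" where
  "face_share e = (\<Sum>F\<in>{F \<in> components (- skeleton E). e \<in> boundary E F}. 1 / card (boundary E F))"

lemma sum_face_share:
  assumes "E \<noteq> {}"
  shows "(\<Sum>e\<in>E. face_share e) = card (components (- skeleton E))"
proof -
  let ?C = "components (- skeleton E)"
  have "(\<Sum>e\<in>E. face_share e) = (\<Sum>F\<in>?C. \<Sum>e\<in>{e \<in> E. e \<in> boundary E F}. 1 / card (boundary E F))"
    unfolding face_share_def using finite_edges[of E] finite_faces[of E]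
    by (intro sum.swap_restrict) auto
  also have "\<dots> = (\<Sum>F\<in>?C. 1)"
  proof (rule sum.cong)
    fix F assume F: "F \<in> ?C"
    have eq: "{e \<in> E. e \<in> boundary E F} = boundary E F" by (auto simp: boundary_def)
    have "finite (boundary E F)" by (rule finite_edges) (auto simp: boundary_def)
    then have "card (boundary E F) \<noteq> 0"
      using boundary_nonempty[OF _ assms F] by simp
    then show "(\<Sum>e\<in>{e \<in> E. e \<in> boundary E F}. 1 / card (boundary E F)) = (1::real)"
      unfolding eq by simp
  qed simp
  finally show ?thesis by simp
qed

lemma face_share_bridge:
  assumes "e \<in> E" "bridge E e" "card E \<ge> 3"
  shows "face_share e \<le> 1 / 3"
proof -
  let ?T = "{F \<in> components (- skeleton E). e \<in> boundary E F}"
  have "?T = {} \<or> (\<exists>F\<in>?T. ?T = {F})"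
    using bridge_one_face[OF _ assms(1,2)] by blast
  then show ?thesis
  proof
    assume "\<exists>F\<in>?T. ?T = {F}"
    then obtain F where F: "F \<in> components (- skeleton E)" "?T = {F}" by blast
    then have "face_share e = 1 / card (boundary E F)" unfolding face_share_def by simp
    moreover have "card (boundary E F) \<ge> 3" using card_boundary_ge_3[OF _ F(1)] assms by auto
    then have "1 / card (boundary E F) \<le> (1 / 3 :: real)" by (simp add: field_simps)
    ultimately show ?thesis by simp
  next
    assume "?T = {}"
    then show ?thesis unfolding face_share_def by (simp only: sum.empty)
  qed
qed

text \<open>At most two faces lie at \<open>e\<close>. Each gives at most 1/4, or 1/3 = 1/4 + 1/12
  if it is triangular, and the triangular ones are counted by their apexes.\<close>

lemma face_share_nonbridge:
  assumes "e \<in> E" "\<not> bridge E e" "card E \<ge> 4"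
  shows "face_share e \<le> 1 / 2 + min (card (common_neighbors e)) 2 / 12"
proof -
  let ?T = "{F \<in> components (- skeleton E). e \<in> boundary E F}"
  let ?s = "\<lambda>F. 1 / real (card (boundary E F))"
  let ?t = "card (common_neighbors e)"
  have fin: "finite (common_neighbors e)"
    by (rule finite_common_neighbors[OF assms(1)])
  have ge3: "card (boundary E F) \<ge> 3" if "F \<in> ?T" for F
    using card_boundary_ge_3[of E F] that assms by auto
  have s3: "?s F \<le> 1 / 3" if "F \<in> ?T" for F
    using ge3[OF that] by (simp add: field_simps)
  have s4: "?s F \<le> 1 / 4" if "F \<in> ?T" "card (boundary E F) \<noteq> 3" for F
    using ge3[OF that(1)] that(2) by (simp add: field_simps)
  have t1: "?t \<ge> 1" if "F \<in> ?T" "card (boundary E F) = 3" for F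
  proof -
    have "F \<in> components (- skeleton E)" "e \<in> boundary E F" using that by auto
    from boundary_triangle_apex[OF this(1) assms(3) that(2) this(2)]
    have "common_neighbors e \<noteq> {}" by auto
    then show ?thesis using fin by (simp add: Suc_leI card_gt_0_iff)
  qed
  have t2: "?t \<ge> 2"
    if F: "F \<in> ?T" "card (boundary E F) = 3" and F': "F' \<in> ?T" "card (boundary E F') = 3" and "F \<noteq> F'" for F F'
  proof -
    have C: "F \<in> components (- skeleton E)" "e \<in> boundary E F" using F(1) by auto
    have C': "F' \<in> components (- skeleton E)" "e \<in> boundary E F'" using F'(1) by auto
    from boundary_triangle_apex[OF C(1) assms(3) F(2) C(2)]
    obtain x where x: "x \<in> common_neighbors e" "boundary E F = insert e ((\<lambda>y. {y, x}) ` e)" .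
    from boundary_triangle_apex[OF C'(1) assms(3) F'(2) C'(2)]
    obtain x' where x': "x' \<in> common_neighbors e" "boundary E F' = insert e ((\<lambda>y. {y, x'}) ` e)" .
    have "x \<noteq> x'"
    proof
      assume "x = x'"
      then have "boundary E F' = boundary E F" using x(2) x'(2) by simp
      from boundary_triangle_unique[OF C(1) F(2) C'(1) this assms(3)] show False
        using \<open>F \<noteq> F'\<close> by simp
    qed
    then have "card {x, x'} = 2" by simp
    then show ?thesis using card_mono[OF fin, of "{x, x'}"] x x' by simp
  qed
  from nonbridge_two_faces[OF subset_refl assms(1,2)]
  obtain F1 F2 where T12: "?T \<subseteq> {F1, F2}" .
  have "X = {} \<or> (\<exists>F. X = {F}) \<or> (\<exists>F F'. X = {F, F'} \<and> F \<noteq> F')"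
    if "X \<subseteq> {F1, F2}" for X :: "complex set set"
  proof -
    have "X = {} \<or> X = {F1} \<or> X = {F2} \<or> X = {F1, F2}" using that by blast
    then show ?thesis by (metis insert_absorb2)
  qed
  from this[OF T12]
  consider "?T = {}" | F where "?T = {F}" | F F' where "?T = {F, F'}" "F \<noteq> F'"
    by metis
  then show ?thesis
  proof cases
    case 1
    then have "face_share e = 0" unfolding face_share_def by (simp only: sum.empty)
    then show ?thesis by simp
  next
    case 2
    then have "face_share e = ?s F" unfolding face_share_def by simp
    moreover have "?s F \<le> 1 / 3" by (rule s3) (simp add: 2)
    ultimately show ?thesis by simp
  next
    case 3
    then have sh: "face_share e = ?s F + ?s F'" unfolding face_share_def by simp
    have FT: "F \<in> ?T" "F' \<in> ?T" unfolding 3(1) by auto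
    consider "?t = 0" | "?t = 1" | "?t \<ge> 2" by linarith
    then show ?thesis
    proof cases
      case 1
      then have "?s F \<le> 1 / 4" "?s F' \<le> 1 / 4"
        using s4[OF FT(1)] s4[OF FT(2)] t1[OF FT(1)] t1[OF FT(2)] by linarith+
      then show ?thesis unfolding sh using 1 by simp
    next
      case 2
      then have "card (boundary E F) \<noteq> 3 \<or> card (boundary E F') \<noteq> 3"
        using t2[OF FT(1) _ FT(2)] 3(2) by linarith
      then have "?s F + ?s F' \<le> 1 / 3 + 1 / 4"
        using s3[OF FT(1)] s3[OF FT(2)] s4[OF FT(1)] s4[OF FT(2)] by linarith
      then show ?thesis unfolding sh using 2 by simp
    next
      case 3
      then show ?thesis unfolding sh using s3[OF FT(1)] s3[OF FT(2)] by simp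
    qed
  qed
qed

lemma sum_edge_weights:
  assumes "card E \<ge> 4"
  shows "(\<Sum>e\<in>E. if bridge E e then 8 else 6 - real (min (card (common_neighbors e)) 2))
    \<le> 12 * real (card V) - 24"
proof -
  have "E \<noteq> {}" using assms by auto
  have "V \<noteq> {}"
  proof
    assume "V = {}"
    then have "card e = 0" if "e \<in> E" for e using edge_subset[OF that] by simp
    then show False using edge_card \<open>E \<noteq> {}\<close> by fastforce
  qed
  have "(\<Sum>e\<in>E. if bridge E e then 8 else 6 - real (min (card (common_neighbors e)) 2))
    \<le> (\<Sum>e\<in>E. 12 * (1 - face_share e))"
  proof (rule sum_mono)
    fix e assume e: "e \<in> E"
    show "(if bridge E e then 8 else 6 - real (min (card (common_neighbors e)) 2)) \<le> 12 * (1 - face_share e)"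
      using face_share_bridge[OF e] face_share_nonbridge[OF e] assms by (auto simp: field_simps)
  qed
  also have "\<dots> = 12 * (real (card E) - real (card (components (- skeleton E))))"
    using sum_face_share[OF \<open>E \<noteq> {}\<close>] by (simp add: sum_distrib_left[symmetric] sum_subtractf)
  also have "\<dots> \<le> 12 * (real (card V) - 2)"
    using Euler_inequality[OF subset_refl \<open>V \<noteq> {}\<close>] by simp
  finally show ?thesis by simp
qed

end

section \<open>Discharging along the edges\<close>

text \<open>
  An edge's share of \<open>12 * (card E - card faces)\<close> is at least this weight: if every face is
  split evenly among its boundary edges, a bridge receives at most 1/3, and any other edge at
  most 1/2 plus 1/12 for each triangular face at it.
\<close>

definition edge_weight :: "'a set set \<Rightarrow> 'a \<Rightarrow> 'a \<Rightarrow> real" where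
  "edge_weight E v w = (if card (neighbors E v) = 1 \<or> card (neighbors E w) = 1 then 8
     else 6 - min (card (neighbors E v \<inter> neighbors E w)) 2)"

lemma sum_neighbors_edges:
  fixes f :: "'a set \<Rightarrow> real"
  assumes sg: "simple_graph V E"
  shows "(\<Sum>v\<in>V. \<Sum>w\<in>neighbors E v. f {v, w}) = 2 * (\<Sum>e\<in>E. f e)"
proof -
  have finV: "finite V" using sg by (simp add: simple_graph_def)
  have finE: "finite E" by (rule simple_graph_finite_edges[OF sg])
  have "(\<Sum>w\<in>neighbors E v. f {v, w}) = (\<Sum>e\<in>{e \<in> E. v \<in> e}. f e)" for v
    unfolding edges_at_eq_image[OF sg]
    by (subst sum.reindex) (auto simp: inj_on_def doubleton_eq_iff)
  then have "(\<Sum>v\<in>V. \<Sum>w\<in>neighbors E v. f {v, w}) = (\<Sum>e\<in>E. \<Sum>v\<in>{v \<in> V. v \<in> e}. f e)"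
    using sum.swap_restrict[OF finV finE, of "\<lambda>v e. f e" "\<lambda>v e. v \<in> e"] by simp
  also have "\<dots> = (\<Sum>e\<in>E. 2 * f e)"
  proof (rule sum.cong)
    fix e assume "e \<in> E"
    then have "e \<subseteq> V" "card e = 2" using sg by (auto simp: simple_graph_def)
    moreover from this have "{v \<in> V. v \<in> e} = e" by blast
    ultimately show "(\<Sum>v\<in>{v \<in> V. v \<in> e}. f e) = 2 * f e" by simp
  qed simp
  finally show ?thesis by (simp add: sum_distrib_left)
qed

text \<open>Summing over vertices counts each edge twice, so this is twice
  \<open>sum_edge_weights\<close>. Replacing bridges by edges at leaves can only lower the weight,
  since any other weight is at most 6.\<close>

lemma (in plane_graph) vertex_charge_ge:
  assumes "card E \<ge> 4"
  shows "48 \<le> (\<Sum>v\<in>V. 24 - (\<Sum>w\<in>neighbors E v. edge_weight E v w))"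
proof -
  let ?f = "\<lambda>e. (if bridge E e then 8 else 6 - real (min (card (common_neighbors e)) 2)) :: real"
  have "edge_weight E v w \<le> ?f {v, w}" if "w \<in> neighbors E v" for v w
  proof -
    have vw: "{v, w} \<in> E" "{w, v} \<in> E" using that by (auto simp: neighbors_def insert_commute)
    show ?thesis
      using bridge_leaf[OF simple _ vw(1)] bridge_leaf[OF simple _ vw(2)]
      by (auto simp: edge_weight_def common_neighbors_pair insert_commute)
  qed
  then have "(\<Sum>v\<in>V. \<Sum>w\<in>neighbors E v. edge_weight E v w) \<le> (\<Sum>v\<in>V. \<Sum>w\<in>neighbors E v. ?f {v, w})"
    by (intro sum_mono)
  also have "\<dots> = 2 * (\<Sum>e\<in>E. ?f e)"
    by (rule sum_neighbors_edges[OF simple])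
  also have "\<dots> \<le> 2 * (12 * real (card V) - 24)"
    using sum_edge_weights[OF assms] by simp
  finally show ?thesis by (simp add: sum_subtractf)
qed

text \<open>
  A vertex of degree at least 6 absorbs all its surplus from a neighbour of degree at most 4
  (there is then at most one, and no neighbour of degree 5), and otherwise 4/5 from each
  neighbour of degree 5 with which it shares two neighbours.
\<close>

lemma vertex_charge_le:
  assumes sg: "simple_graph V E"
    and nonisolated: "\<And>v. v \<in> V \<Longrightarrow> neighbors E v \<noteq> {}"
    and adj: "\<And>u v. v \<in> neighbors E u \<Longrightarrow>
      card (neighbors E u) + card (neighbors E v) \<ge> 10 + card (neighbors E u \<inter> neighbors E v)"
    and common: "\<And>u v w. u \<noteq> v \<Longrightarrow> w \<in> neighbors E u \<Longrightarrow> w \<in> neighbors E v \<Longrightarrow>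
      card (neighbors E u) + card (neighbors E v) \<ge> 10"
  shows "(\<Sum>v\<in>V. 24 - (\<Sum>w\<in>neighbors E v. edge_weight E v w)) \<le> 0"
proof -
  define N where "N = neighbors E"
  define d where "d v = card (N v)" for v
  define t where "t v w = card (N v \<inter> N w)" for v w
  \<comment> \<open>\<open>s v w\<close> is the charge that \<open>v\<close> takes over from
    \<open>w\<close>. Every edge weighs at least 4, so \<open>4 * d v - 24\<close> is what
    \<open>v\<close> can always absorb; an edge to a leaf weighs 8, which allows 4 more.\<close>
  define s :: "'a \<Rightarrow> 'a \<Rightarrow> real" where
    "s v w = (if d w \<le> 4 then 4 * real (d v) - 24 + (if d w = 1 then 4 else 0)
      else if d w = 5 \<and> t v w \<ge> 2 then 4 / 5 else 0)" for v w
  \<comment> \<open>After the transfers, \<open>v\<close> holds 24 plus the sum of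
    \<open>m v w\<close>. It remains to bring this to at most 0 at every vertex.\<close>
  define m where "m v w = s v w - s w v - edge_weight E v w" for v w
  have finV: "finite V" using sg by (simp add: simple_graph_def)
  have fin: "finite (N v)" for v
    unfolding N_def by (rule simple_graph_finite_neighbors[OF sg])
  have sym: "w \<in> N v \<longleftrightarrow> v \<in> N w" for v w
    unfolding N_def by (rule neighbors_sym)
  have NV: "N v \<subseteq> V" for v
    unfolding N_def using simple_graph_neighbors[OF sg] by blast
  have t_sym: "t v w = t w v" for v w by (simp add: t_def Int_commute)
  have adj': "d v + d w \<ge> 10 + t v w" if "w \<in> N v" for v w
    using adj[of w v] that by (simp add: d_def t_def N_def)
  have common': "d v + d w \<ge> 10" if "v \<noteq> w" "x \<in> N v" "x \<in> N w" for v w x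
    using common[of v w x] that by (simp add: d_def N_def)
  have ew: "edge_weight E v w = (if d v = 1 \<or> d w = 1 then 8 else 6 - min (real (t v w)) 2)" for v w
    by (simp add: edge_weight_def d_def t_def N_def of_nat_min)
  have ew4: "edge_weight E v w \<ge> 4" for v w
    by (auto simp: ew)
  have "(\<Sum>w\<in>N v. m v w) \<le> - 24" if v: "v \<in> V" for v
  proof -
    have d0: "d v > 0"
      using nonisolated[OF v] fin[of v] by (simp add: d_def N_def card_gt_0_iff)
    have uniform: ?thesis if "\<And>w. w \<in> N v \<Longrightarrow> m v w \<le> - 24 / real (d v)"
    proof -
      have "(\<Sum>w\<in>N v. m v w) \<le> real (card (N v)) * (- 24 / real (d v))"
        by (rule sum_bounded_above) (rule that)
      also have "\<dots> = - 24" using d0 by (simp add: d_def)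
      finally show ?thesis .
    qed
    consider "d v \<le> 4" | "d v = 5" | u where "d v \<ge> 6" "u \<in> N v" "d u \<le> 4"
      | "d v \<ge> 6" "\<And>w. w \<in> N v \<Longrightarrow> d w \<ge> 5"
      by force
    then show ?thesis
    proof cases
      case 1
      show ?thesis
      proof (rule uniform)
        \<comment> \<open>By \<open>adj'\<close>, \<open>d w\<close> is at least
          \<open>10 - d v + t v w\<close>. For each of the four degrees, the transfer and the edge
          weight together then reach \<open>24 / d v\<close>.\<close>
        fix w assume w: "w \<in> N v"
        have a: "real (d v) + real (d w) \<ge> 10 + real (t v w)" using adj'[OF w] by linarith
        have dw: "d w \<ge> 6" using adj'[OF w] 1 by linarith
        have "s v w = 0" using dw adj'[OF w] 1 by (auto simp: s_def)
        moreover have "s w v = 4 * real (d w) - 24 + (if d v = 1 then 4 else 0)"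
          using 1 by (simp add: s_def)
        ultimately have m: "m v w = - (4 * real (d w) - 24 + (if d v = 1 then 4 else 0)) - edge_weight E v w"
          by (simp add: m_def)
        consider "d v = 1" | "d v = 2" | "d v = 3" | "d v = 4" using 1 d0 by linarith
        then show "m v w \<le> - 24 / real (d v)"
          by cases (use m a dw in \<open>auto simp: ew min_def split: if_splits\<close>)
      qed
    next
      case 2
      show ?thesis
      proof (rule uniform)
        \<comment> \<open>The target per edge is 24/5. With at most one common neighbour the weight
          is at least 5; otherwise it is 4, and the transfer 4/5 makes up the difference.\<close>
        fix w assume w: "w \<in> N v"
        have "s v w = 0" using adj'[OF w] 2 by (auto simp: s_def)
        moreover have "s w v = (if t v w \<ge> 2 then 4 / 5 else 0)" using 2 by (simp add: s_def t_sym)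
        ultimately have m: "m v w = - (if t v w \<ge> 2 then 4 / 5 else 0) - edge_weight E v w"
          by (simp add: m_def)
        have "d w \<ge> 5" using adj'[OF w] 2 by linarith
        then show "m v w \<le> - 24 / real (d v)"
          using m 2 by (auto simp: ew min_def)
      qed
    next
      case 3
      \<comment> \<open>The neighbours of \<open>v\<close> other than \<open>u\<close> have degree
        at least 6 by \<open>common'\<close>, so no charge arrives from them. The total is at most
        \<open>(4 * d v - 28) - 4 * (d v - 1) = - 24\<close>.\<close>
      have out: "m v w \<le> - 4" if "w \<in> N v - {u}" for w
      proof -
        have "d u + d w \<ge> 10" using common'[of u w v] that 3(2) sym by auto
        then have "d w \<ge> 6" using 3 by linarith
        then show ?thesis using 3(1) ew4[of v w] by (simp add: m_def s_def)
      qed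
      have "s u v = 0" using 3(1) by (simp add: s_def)
      then have "m v u \<le> 4 * real (d v) - 28"
        using 3 ew4[of v u] by (auto simp: m_def s_def ew)
      moreover have "(\<Sum>w\<in>N v - {u}. m v w) \<le> real (card (N v - {u})) * (- 4)"
        by (rule sum_bounded_above) (rule out)
      moreover have "real (card (N v - {u})) = real (d v) - 1"
        using 3(2) fin[of v] d0 by (simp add: d_def of_nat_diff)
      moreover have "(\<Sum>w\<in>N v. m v w) = m v u + (\<Sum>w\<in>N v - {u}. m v w)"
        by (rule sum.remove[OF fin 3(2)])
      ultimately show ?thesis by linarith
    next
      case 4
      define S where "S = {w \<in> N v. d w = 5 \<and> t v w \<ge> 2}"
      have m: "m v w \<le> (if w \<in> S then 4 / 5 else 0) - 4" if "w \<in> N v" for w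
        using 4(1) 4(2)[OF that] ew4[of v w] that by (auto simp: m_def s_def S_def)
      have SN: "S \<subseteq> N v" by (auto simp: S_def)
      have "(\<Sum>w\<in>N v. m v w) \<le> (\<Sum>w\<in>N v. (if w \<in> S then 4 / 5 else 0) - 4)"
        by (rule sum_mono) (rule m)
      also have "\<dots> = 4 / 5 * real (card S) - 4 * real (d v)"
        using SN fin[of v] by (simp add: sum_subtractf sum.If_cases d_def Int_absorb1 Int_def[symmetric])
      finally have sum: "(\<Sum>w\<in>N v. m v w) \<le> 4 / 5 * real (card S) - 4 * real (d v)" .
      have cS: "card S \<le> d v" unfolding d_def by (rule card_mono[OF fin SN])
      consider "S = {}" | "d v \<ge> 8" | w where "w \<in> S" "d v \<le> 7" by force
      then show ?thesis
      proof cases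
        case 1
        then show ?thesis using sum 4(1) by simp
      next
        case 2
        then show ?thesis using sum cS by simp
      next
        case 3
        then have w: "w \<in> N v" "d w = 5" "t v w \<ge> 2" by (auto simp: S_def)
        have d7: "d v = 7" using adj'[OF w(1)] w 3 by linarith
        \<comment> \<open>Adjacent members of \<open>S\<close> would have degree sum 10 and the
          common neighbour \<open>v\<close>, against \<open>adj'\<close>. So the common neighbours
          of \<open>v\<close> and \<open>w\<close>, at least two, lie outside \<open>S\<close>,
          leaving at most 5 of the 7 neighbours.\<close>
        have "x \<notin> S" if x: "x \<in> N v \<inter> N w" for x
        proof
          assume "x \<in> S"
          have "v \<in> N x \<inter> N w" using x w(1) sym by blast
          then have "t x w \<ge> 1"
            using fin[of x] by (metis One_nat_def Suc_leI card_gt_0_iff emptyE finite_Int t_def)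
          moreover have "w \<in> N x" using x sym by blast
          ultimately have "d x + d w \<ge> 11" using adj'[of w x] by linarith
          then show False using \<open>x \<in> S\<close> w by (simp add: S_def)
        qed
        then have "S \<subseteq> N v - (N v \<inter> N w)" using SN by blast
        then have "card S \<le> card (N v - (N v \<inter> N w))" using fin by (intro card_mono) auto
        also have "\<dots> = d v - t v w" using fin by (simp add: card_Diff_subset d_def t_def)
        finally have "card S \<le> 5" using d7 w by linarith
        then show ?thesis using sum d7 by simp
      qed
    qed
  qed
  then have "(\<Sum>v\<in>V. \<Sum>w\<in>N v. m v w) \<le> (\<Sum>v\<in>V. - 24)" by (rule sum_mono)
  \<comment> \<open>Transfers cancel in the total, as each is added at one end of an edge and
    subtracted at the other.\<close>
  moreover have "(\<Sum>v\<in>V. \<Sum>w\<in>N v. m v w) = - (\<Sum>v\<in>V. \<Sum>w\<in>N v. edge_weight E v w)"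
  proof -
    have restr: "N v = {w \<in> V. w \<in> N v}" for v using NV by blast
    have "(\<Sum>v\<in>V. \<Sum>w\<in>N v. s v w) = (\<Sum>v\<in>V. \<Sum>w\<in>{w \<in> V. w \<in> N v}. s v w)"
      using restr by simp
    also have "\<dots> = (\<Sum>w\<in>V. \<Sum>v\<in>{v \<in> V. w \<in> N v}. s v w)"
      by (rule sum.swap_restrict[OF finV finV])
    also have "\<dots> = (\<Sum>w\<in>V. \<Sum>v\<in>N w. s v w)"
    proof -
      have "{v \<in> V. w \<in> N v} = N w" for w using NV sym by blast
      then show ?thesis by simp
    qed
    finally show ?thesis by (simp add: m_def sum_subtractf)
  qed
  ultimately show ?thesis
    by (simp add: sum_subtractf N_def)
qed

theorem theorem3p10:
  fixes V :: "'a set" and E :: "'a set set"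
  assumes "simple_graph V E"
    and "connected_graph V E"
    and "planar_graph V E"
    and "card V \<ge> 2"
  shows "b_dR V E \<le> 8"
proof (rule ccontr)
  assume "\<not> b_dR V E \<le> 8"
  then have large: "10 + k \<le> n" if "b_dR V E + enat k + 1 \<le> enat n" for k n
    using that by (cases "b_dR V E") (auto simp: one_enat_def numeral_eq_enat)
  let ?N = "neighbors E"
  have adj: "10 + card (?N u \<inter> ?N v) \<le> card (?N u) + card (?N v)" if "v \<in> ?N u" for u v
    using large[OF b_dR_le_adjacent[OF assms(1)]] that by (simp add: neighbors_def)
  have common: "10 \<le> card (?N u) + card (?N v)" if "u \<noteq> v" "w \<in> ?N u" "w \<in> ?N v" for u v w
    using large[of 0] b_dR_le_common_neighbor[OF assms(1) that] by (simp add: zero_enat_def[symmetric])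
  have nonisolated: "?N v \<noteq> {}" if v: "v \<in> V" for v
  proof -
    have "V \<noteq> {v}" using assms(4) by auto
    then obtain w where "w \<in> V" "w \<noteq> v" using v by blast
    then have "(v, w) \<in> linked E"
      using assms(2) v by (simp add: connected_graph_def linked_def)
    then show ?thesis
      using linked_first_edge \<open>w \<noteq> v\<close> by (metis empty_iff mem_Collect_eq neighbors_def)
  qed
  have deg: "card (?N x) \<le> card E" for x
    using card_mono[OF simple_graph_finite_edges[OF assms(1)], of "{e \<in> E. x \<in> e}"]
      card_edges_at[OF assms(1), of x] by auto
  obtain v where "v \<in> V" using assms(4) by fastforce
  then obtain w where "w \<in> ?N v" using nonisolated by blast
  \<comment> \<open>Two adjacent degrees sum to at least 10, so one of them is at least 5, and
    \<open>deg\<close> bounds it by the number of edges.\<close>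
  then have "card E \<ge> 4" using adj[of w v] deg[of v] deg[of w] by linarith
  moreover obtain p g where "plane_drawing V E p g"
    using assms(3) by (auto simp: planar_graph_def)
  ultimately have "48 \<le> (\<Sum>v\<in>V. 24 - (\<Sum>w\<in>?N v. edge_weight E v w))"
    using assms(1) by (intro plane_graph.vertex_charge_ge plane_graph.intro)
  moreover have "(\<Sum>v\<in>V. 24 - (\<Sum>w\<in>?N v. edge_weight E v w)) \<le> 0"
    by (rule vertex_charge_le[OF assms(1)]) (use nonisolated adj common in blast)+
  ultimately show False by linarith
qed

end
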